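(* Consider the $K$-user MIMO broadcast channel with transmit correlation described in the context, without free CSIR. Suppose the correlation eigenvectors are nested: for each $k\in\{2,\dots,K\}$, $\mathbf U_{k-1}=[\bar{\mathbf U}_k\ \mathbf U_k]$, where $\bar{\mathbf U}_k$ is an orthonormal basis of the orthogonal complement of $\mathrm{Span}(\mathbf U_k)$ in $\mathrm{Span}(\mathbf U_{k-1})$ (so $r_1\ge r_2\ge\dots\ge r_K$). Then the DoF tuple $(d_1,\dots,d_K)$ with $$d_1=N_1^*\Big(1-\frac{r_1}{T}\Big),\qquad d_k=N_k^*\,\frac{r_{k-1}-r_k}{T},\quad k\in\{2,\dots,K\},$$ is achievable.
   Context: Model: a transmitter with $M$ antennas serves $K$ users; user $k$ has $N_k$ antennas. At each channel use user $k$ receives $\mathbf y_k=\mathbf H_k\mathbf x+\mathbf w_k$, with $\mathbf w_k$ i.i.d. $\mathcal{CN}(0,1)$ and power constraint $\frac1J\sum_{j=1}^J\|\mathbf x(j)\|^2\le\rho$ per codeword. $\mathbf H_k=\mathbf G_k\boldsymbol\Sigma_k^{1/2}\mathbf U_k^H$, where $\mathbf R_k=\frac1{N_k}\mathbb E[\mathbf H_k^H\mathbf H_k]=\mathbf U_k\boldsymbol\Sigma_k\mathbf U_k^H$ has rank $r_k$ and trace $M$, $\mathbf U_k\in\mathbb C^{M\times r_k}$ has orthonormal columns, $\boldsymbol\Sigma_k$ is positive diagonal, and $\mathbf G_k\in\mathbb C^{N_k\times r_k}$ is random with $h(\mathbf G_k)>-\infty$ and $\mathbb E[\mathbf G_k^H\mathbf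 G_k]=N_k\mathbf I_{r_k}$. Statistics are known to the transmitter and user $k$; the transmitter never knows realizations. No free CSIR: block fading, each $\mathbf H_k$ constant over synchronous blocks of $T$ channel uses and independent across blocks, $T\ge2\max_k\max(r_k,N_k)$, user $k$ knows only the distribution of $\mathbf H_k$. Independent messages; a DoF tuple is achievable if there are achievable rate tuples at every SNR $\rho$ with $d_k=\lim_{\rho\to\infty}R_k(\rho)/\log\rho$. $N_k^*=\min(N_k,r_k)$. *)

theory Defs
  imports "HOL-Probability.Probability"
begin

text \<open>Conventions. Users are indexed 1..K. Matrices with per-user dimensions are
functions on index pairs (row, column) restricted to explicit finite carriers.
A codeword of L fading blocks has length J = L*T; x j i is the input at time j < J
on antenna i < M.  Rates are measured in nats, DoF are limits of R / ln rho.\<close>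

definition CN01 :: "complex measure" where
  "CN01 = density lborel (\<lambda>z. ennreal (exp (- (cmod z)\<^sup>2) / pi))"

definition Gspace :: "nat \<Rightarrow> nat \<Rightarrow> (nat \<times> nat \<Rightarrow> complex) measure" where
  "Gspace Nk rk = PiM ({..<Nk} \<times> {..<rk}) (\<lambda>_. borel)"

definition Gleb :: "nat \<Rightarrow> nat \<Rightarrow> (nat \<times> nat \<Rightarrow> complex) measure" where
  "Gleb Nk rk = PiM ({..<Nk} \<times> {..<rk}) (\<lambda>_. lborel)"

text \<open>Differential entropy strictly greater than minus infinity: the law has a density f
w.r.t. Lebesgue measure and the positive part of f ln f has finite integral.\<close>
definition diff_entropy_gt_minf :: "(nat \<times> nat \<Rightarrow> complex) measure \<Rightarrow> nat \<Rightarrow> nat \<Rightarrow> bool" where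
  "diff_entropy_gt_minf P Nk rk \<longleftrightarrow>
     (\<exists>f. f \<in> borel_measurable (Gleb Nk rk) \<and> (\<forall>x. 0 \<le> f x) \<and>
          P = density (Gleb Nk rk) (\<lambda>x. ennreal (f x)) \<and>
          (\<integral>\<^sup>+ x. ennreal (f x * ln (f x)) \<partial>Gleb Nk rk) < \<infinity>)"

text \<open>H = G Sigma^(1/2) U^H, entry (a,i).\<close>
definition chanH :: "(nat \<Rightarrow> nat \<Rightarrow> complex) \<Rightarrow> (nat \<Rightarrow> real) \<Rightarrow> nat
     \<Rightarrow> (nat \<times> nat \<Rightarrow> complex) \<Rightarrow> nat \<Rightarrow> nat \<Rightarrow> complex" where
  "chanH Uk sk rk G a i = (\<Sum>b<rk. G (a, b) * complex_of_real (sqrt (sk b)) * cnj (Uk i b))"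

definition out_space :: "nat \<Rightarrow> nat \<Rightarrow> (nat \<times> nat \<Rightarrow> complex) measure" where
  "out_space Nk J = PiM ({..<J} \<times> {..<Nk}) (\<lambda>_. borel)"

definition user_space :: "(nat \<times> nat \<Rightarrow> complex) measure \<Rightarrow> nat \<Rightarrow> nat \<Rightarrow> nat
     \<Rightarrow> ((nat \<Rightarrow> (nat \<times> nat \<Rightarrow> complex)) \<times> (nat \<times> nat \<Rightarrow> complex)) measure" where
  "user_space Gd Nk T L = PiM {..<L} (\<lambda>_. Gd) \<Otimes>\<^sub>M PiM ({..<L*T} \<times> {..<Nk}) (\<lambda>_. CN01)"

definition received :: "nat \<Rightarrow> nat \<Rightarrow> nat \<Rightarrow> (nat \<Rightarrow> nat \<Rightarrow> complex) \<Rightarrow> (nat \<Rightarrow> real) \<Rightarrow> nat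
     \<Rightarrow> nat \<Rightarrow> (nat \<Rightarrow> nat \<Rightarrow> complex)
     \<Rightarrow> ((nat \<Rightarrow> (nat \<times> nat \<Rightarrow> complex)) \<times> (nat \<times> nat \<Rightarrow> complex)) \<Rightarrow> (nat \<times> nat \<Rightarrow> complex)" where
  "received M T Nk Uk sk rk L x \<omega> =
     restrict (\<lambda>(j, a). (\<Sum>i<M. chanH Uk sk rk (fst \<omega> (j div T)) a i * x j i) + snd \<omega> (j, a))
              ({..<L*T} \<times> {..<Nk})"

definition messages :: "nat \<Rightarrow> (nat \<Rightarrow> nat) \<Rightarrow> (nat \<Rightarrow> nat) set" where
  "messages K m = PiE {1..K} (\<lambda>k. {..<m k})"

definition err_prob :: "nat \<Rightarrow> nat \<Rightarrow> nat \<Rightarrow> (nat \<Rightarrow> nat) \<Rightarrow> (nat \<Rightarrow> nat \<Rightarrow> nat \<Rightarrow> complex)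
     \<Rightarrow> (nat \<Rightarrow> nat \<Rightarrow> real) \<Rightarrow> (nat \<Rightarrow> nat) \<Rightarrow> (nat \<Rightarrow> (nat \<times> nat \<Rightarrow> complex) measure) \<Rightarrow> nat
     \<Rightarrow> (nat \<Rightarrow> nat) \<Rightarrow> ((nat \<Rightarrow> nat) \<Rightarrow> nat \<Rightarrow> nat \<Rightarrow> complex)
     \<Rightarrow> (nat \<Rightarrow> (nat \<times> nat \<Rightarrow> complex) \<Rightarrow> nat) \<Rightarrow> nat \<Rightarrow> real" where
  "err_prob M K T N U s r Gd L m f g k =
     (1 / real (card (messages K m))) *
     (\<Sum>w\<in>messages K m.
        measure (user_space (Gd k) (N k) T L)
          {\<omega> \<in> space (user_space (Gd k) (N k) T L).
             g k (received M T (N k) (U k) (s k) (r k) L (f w) \<omega>) \<noteq> w k})"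

definition achievable_rates :: "nat \<Rightarrow> nat \<Rightarrow> nat \<Rightarrow> (nat \<Rightarrow> nat) \<Rightarrow> (nat \<Rightarrow> nat \<Rightarrow> nat \<Rightarrow> complex)
     \<Rightarrow> (nat \<Rightarrow> nat \<Rightarrow> real) \<Rightarrow> (nat \<Rightarrow> nat) \<Rightarrow> (nat \<Rightarrow> (nat \<times> nat \<Rightarrow> complex) measure)
     \<Rightarrow> real \<Rightarrow> (nat \<Rightarrow> real) \<Rightarrow> bool" where
  "achievable_rates M K T N U s r Gd \<rho> R \<longleftrightarrow>
     (\<forall>k\<in>{1..K}. 0 \<le> R k) \<and>
     (\<forall>\<epsilon>>0. \<exists>L0. \<forall>L\<ge>L0. \<exists>m f g.
        (\<forall>k\<in>{1..K}. exp (real (L * T) * R k) \<le> real (m k)) \<and>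
        (\<forall>w\<in>messages K m. (1 / real (L * T)) * (\<Sum>j<L*T. \<Sum>i<M. (cmod (f w j i))\<^sup>2) \<le> \<rho>) \<and>
        (\<forall>k\<in>{1..K}. g k \<in> measurable (out_space (N k) (L * T)) (count_space UNIV)) \<and>
        (\<forall>k\<in>{1..K}. err_prob M K T N U s r Gd L m f g k \<le> \<epsilon>))"

definition dof_achievable :: "nat \<Rightarrow> nat \<Rightarrow> nat \<Rightarrow> (nat \<Rightarrow> nat) \<Rightarrow> (nat \<Rightarrow> nat \<Rightarrow> nat \<Rightarrow> complex)
     \<Rightarrow> (nat \<Rightarrow> nat \<Rightarrow> real) \<Rightarrow> (nat \<Rightarrow> nat) \<Rightarrow> (nat \<Rightarrow> (nat \<times> nat \<Rightarrow> complex) measure)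
     \<Rightarrow> (nat \<Rightarrow> real) \<Rightarrow> bool" where
  "dof_achievable M K T N U s r Gd d \<longleftrightarrow>
     (\<exists>R :: real \<Rightarrow> nat \<Rightarrow> real.
        (\<forall>\<rho>>0. achievable_rates M K T N U s r Gd \<rho> (R \<rho>)) \<and>
        (\<forall>k\<in>{1..K}. ((\<lambda>\<rho>. R \<rho> k / ln \<rho>) \<longlongrightarrow> d k) at_top))"

end

theory Submission
  imports Defs "Jordan_Normal_Form.Determinant"
begin

text \<open>
  The scheme is product superposition. Count the coordinates of the common eigenbasis from its end, so
  that user \<open>k\<close> sees exactly the coordinates below \<open>r k\<close>, and put \<open>r 0 = T\<close>. The slots
  \<open>r k \<le> t < r (k - 1)\<close> of a block belong to user \<open>k\<close>. The signal in slot \<open>t\<close> is the pilot in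
  coordinate \<open>t\<close> plus the combination of the signals of the slots \<open>c < min (N k) (r k)\<close> with the data
  symbols of user \<open>k\<close> as coefficients. User \<open>k\<close> does not see that pilot, so whatever the
  other users' data are, it receives in its data slots combinations, with its own data as coefficients,
  of what it received in the first slots, which thus serve as pilots for its effective channel. That effective channel is the true one
  times a unit upper triangular matrix, so it separates the data symbols as well as the true channel,
  which is almost surely invertible on \<open>min (N k) (r k)\<close> coordinates because its law has a density.

  The data symbols form a grid of spacing proportional to \<open>1 / sqrt \<rho>\<close>, with a factor that
  depends only on the allowed probability of a bad block. Whether a block is bad depends on its fading
  and noise alone. A Gilbert--Varshamov code over the blocks then corrects the small fraction of bad
  blocks at a rate loss which vanishes relative to \<open>ln \<rho>\<close>.
\<close>

section \<open>Diagonal choice of a vanishing rate loss\<close>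

text \<open>Diagonal argument: at \<open>x\<close> take the smallest \<open>1 / (n + 2)\<close> with
  \<open>n \<le> x\<close> whose threshold \<open>x\<close> has passed. It later merges the schemes
  for each fixed rate loss into one whose loss vanishes.\<close>

lemma vanishing_selection:
  fixes P :: "real \<Rightarrow> real \<Rightarrow> bool"
  assumes "\<And>e. 0 < e \<Longrightarrow> e < 1 \<Longrightarrow> eventually (P e) at_top"
  obtains e where "(e \<longlongrightarrow> 0) at_top" "eventually (\<lambda>x. P (e x) x) at_top"
proof -
  define d where "d n = 1 / (real n + 2)" for n
  have "\<exists>c. \<forall>x\<ge>c. P (d n) x" for n
    using assms[of "d n"] by (auto simp: d_def eventually_at_top_linorder)
  then obtain c where c: "\<And>n x. c n \<le> x \<Longrightarrow> P (d n) x" by metis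
  \<comment> \<open>The clause \<open>n \<le> x\<close> keeps \<open>S x\<close> finite, so that
    \<open>Max\<close> is meaningful even if the thresholds are bounded. Where \<open>S x\<close> is
    empty \<open>e x\<close> is arbitrary, but \<open>0\<close> lies in \<open>S x\<close> for all
    large \<open>x\<close>.\<close>
  define S where "S x = {n. real n \<le> x \<and> c n \<le> x}" for x
  have fin: "finite (S x)" for x
  proof (rule finite_subset)
    show "S x \<subseteq> {..nat \<lfloor>x\<rfloor>}" by (auto simp: S_def le_nat_floor)
  qed simp
  define e where "e x = d (Max (S x))" for x
  have ev: "eventually (\<lambda>x. n \<in> S x) at_top" for n
    using eventually_ge_at_top[of "max (real n) (c n)"]
    by eventually_elim (auto simp: S_def)
  show thesis
  proof (rule that[of e])
    show "eventually (\<lambda>x. P (e x) x) at_top"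
      using ev[of 0]
    proof eventually_elim
      case (elim x)
      hence "Max (S x) \<in> S x" using fin by (intro Max_in) auto
      thus ?case unfolding e_def by (intro c) (simp add: S_def)
    qed
    show "(e \<longlongrightarrow> 0) at_top"
    proof (rule tendstoI)
      fix a :: real assume "0 < a"
      then obtain n :: nat where n: "1 / a < real n" using reals_Archimedean2 by blast
      show "eventually (\<lambda>x. dist (e x) 0 < a) at_top"
        using ev[of n]
      proof eventually_elim
        case (elim x)
        hence "n \<le> Max (S x)" using fin by (intro Max_ge) auto
        hence "1 / a < real (Max (S x)) + 2" using n by linarith
        thus ?case using \<open>0 < a\<close> by (simp add: e_def d_def field_simps)
      qed
    qed
  qed
qed

section \<open>Codes\<close>

definition hdist :: "nat \<Rightarrow> (nat \<Rightarrow> 'a) \<Rightarrow> (nat \<Rightarrow> 'a) \<Rightarrow> nat" where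
  "hdist L x y = card {l. l < L \<and> x l \<noteq> y l}"

lemma hdist_commute: "hdist L x y = hdist L y x"
  by (simp add: hdist_def eq_commute)

text \<open>A word in the ball is fixed by the set of positions where it differs from the centre and
  by its letters there. The crude factor \<open>2 ^ L\<close> costs \<open>ln 2\<close> per block,
  which is negligible against \<open>ln \<rho>\<close>.\<close>

lemma card_hamming_ball_le:
  fixes A :: "'a set"
  assumes A: "finite A" "A \<noteq> {}"
  shows "card {y \<in> PiE {..<L} (\<lambda>_. A). hdist L x y \<le> t} \<le> 2 ^ L * card A ^ t"
proof -
  let ?F = "\<lambda>S. (\<lambda>z l. if l \<in> S then z l else if l < L then x l else undefined) ` (PiE S (\<lambda>_. A))"
  let ?P = "{S. S \<subseteq> {..<L} \<and> card S \<le> t}"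
  have finP: "finite ?P" by (rule finite_subset[of _ "Pow {..<L}"]) auto
  have finS: "finite S" if "S \<in> ?P" for S
    using that finite_subset[of S "{..<L}"] by simp
  have "{y \<in> PiE {..<L} (\<lambda>_. A). hdist L x y \<le> t} \<subseteq> (\<Union>S\<in>?P. ?F S)"
  proof
    fix y assume y: "y \<in> {y \<in> PiE {..<L} (\<lambda>_. A). hdist L x y \<le> t}"
    define S where "S = {l. l < L \<and> x l \<noteq> y l}"
    have "S \<in> ?P" using y by (auto simp: S_def hdist_def)
    have rS: "restrict y S \<in> PiE S (\<lambda>_. A)" using y by (auto simp: S_def PiE_iff)
    have yS: "y = (\<lambda>l. if l \<in> S then restrict y S l else if l < L then x l else undefined)"
    proof
      fix l
      show "y l = (if l \<in> S then restrict y S l else if l < L then x l else undefined)"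
        using y by (cases "l < L") (auto simp: S_def PiE_iff extensional_def)
    qed
    have "y \<in> ?F S"
      by (rule image_eqI[where x = "restrict y S"]) (rule yS, rule rS)
    with \<open>S \<in> ?P\<close> show "y \<in> (\<Union>S\<in>?P. ?F S)" by (rule UN_I)
  qed
  moreover have "finite (\<Union>S\<in>?P. ?F S)"
  proof (rule finite_UN_I[OF finP])
    fix S assume "S \<in> ?P"
    from finS[OF this] show "finite (?F S)" by (intro finite_imageI finite_PiE A(1))
  qed
  ultimately have "card {y \<in> PiE {..<L} (\<lambda>_. A). hdist L x y \<le> t} \<le> card (\<Union>S\<in>?P. ?F S)"
    by (intro card_mono)
  also have "\<dots> \<le> (\<Sum>S\<in>?P. card (?F S))" by (rule card_UN_le[OF finP])
  also have "\<dots> \<le> (\<Sum>S\<in>?P. card A ^ t)"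
  proof (rule sum_mono)
    fix S assume S: "S \<in> ?P"
    have "card (?F S) \<le> card (PiE S (\<lambda>_. A))"
      by (rule card_image_le) (rule finite_PiE[OF finS[OF S] A(1)])
    also have "\<dots> = card A ^ card S" using finS[OF S] by (simp add: card_PiE)
    also have "\<dots> \<le> card A ^ t" using S A
      by (intro power_increasing) (auto simp: Suc_le_eq card_gt_0_iff)
    finally show "card (?F S) \<le> card A ^ t" .
  qed
  also have "\<dots> = card ?P * card A ^ t" by simp
  also have "\<dots> \<le> card (Pow {..<L}) * card A ^ t"
    by (rule mult_right_mono[OF card_mono]) auto
  finally show ?thesis by (simp add: card_Pow)
qed

text \<open>Gilbert--Varshamov: the balls around a maximal code cover all words.\<close>

lemma gilbert_varshamov:
  fixes A :: "'a set"
  assumes A: "finite A" "A \<noteq> {}"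
  obtains C where "C \<subseteq> PiE {..<L} (\<lambda>_. A)"
    "\<And>x y. x \<in> C \<Longrightarrow> y \<in> C \<Longrightarrow> x \<noteq> y \<Longrightarrow> t < hdist L x y"
    "card A ^ L \<le> card C * (2 ^ L * card A ^ t)"
proof -
  let ?W = "PiE {..<L} (\<lambda>_. A)"
  let ?Q = "{C. C \<subseteq> ?W \<and> (\<forall>x\<in>C. \<forall>y\<in>C. x \<noteq> y \<longrightarrow> t < hdist L x y)}"
  have finW: "finite ?W" using A by (auto intro: finite_PiE)
  have "?Q \<subseteq> Pow ?W" by blast
  hence "finite ?Q" by (rule finite_subset) (simp add: finW)
  moreover have "{} \<in> ?Q" by simp
  ultimately obtain C where C: "C \<in> ?Q" and max: "\<And>D. D \<in> ?Q \<Longrightarrow> C \<subseteq> D \<Longrightarrow> C = D"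
    using finite_has_maximal[of ?Q] by (metis (no_types, lifting) empty_iff)
  have finC: "finite C" using C finW finite_subset[of C ?W] by simp
  have cover: "?W \<subseteq> (\<Union>x\<in>C. {y \<in> ?W. hdist L x y \<le> t})"
  proof
    fix y assume y: "y \<in> ?W"
    show "y \<in> (\<Union>x\<in>C. {y \<in> ?W. hdist L x y \<le> t})"
    proof (rule ccontr)
      assume no: "\<not> ?thesis"
      have far: "t < hdist L x y" if "x \<in> C" for x
      proof (rule ccontr)
        assume "\<not> t < hdist L x y"
        hence "y \<in> {y \<in> ?W. hdist L x y \<le> t}" using y by simp
        with no that show False by blast
      qed
      \<comment> \<open>A word outside all balls could be adjoined to the maximal code; but as a
        codeword it lies in its own ball.\<close>
      have "insert y C \<in> ?Q"
        using C y far far[unfolded hdist_commute[of L _ y]] by simp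
      from max[OF this subset_insertI] have "y \<in> C"
        by (rule subsetD[OF equalityD2 insertI1])
      moreover have "hdist L y y \<le> t" by (simp add: hdist_def)
      ultimately show False using no y by simp
    qed
  qed
  have "card ?W \<le> card (\<Union>x\<in>C. {y \<in> ?W. hdist L x y \<le> t})"
    by (rule card_mono[OF finite_UN_I[OF finC] cover]) (simp add: finW)
  also have "\<dots> \<le> (\<Sum>x\<in>C. card {y \<in> ?W. hdist L x y \<le> t})" by (rule card_UN_le[OF finC])
  also have "\<dots> \<le> (\<Sum>x\<in>C. 2 ^ L * card A ^ t)"
    by (rule sum_mono) (rule card_hamming_ball_le[OF A])
  finally have "card A ^ L \<le> card C * (2 ^ L * card A ^ t)"
    by (simp add: card_PiE)
  moreover from C have "C \<subseteq> ?W" "\<And>x y. x \<in> C \<Longrightarrow> y \<in> C \<Longrightarrow> x \<noteq> y \<Longrightarrow> t < hdist L x y"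
    by blast+
  ultimately show thesis by (intro that[of C])
qed

text \<open>Logarithm of the Gilbert--Varshamov bound: per block the balls cost \<open>ln 2\<close>
  and the fraction \<open>4 / h\<close> of \<open>ln (card A)\<close>. The distance is twice the
  decoding radius used later. A nonpositive rate is met by one codeword, which covers the case of a
  user without data slots.\<close>

lemma codebook_exists:
  fixes A :: "'a set" and x :: real
  assumes A: "finite A" "A \<noteq> {}" and h: "0 < h"
    and x: "x \<le> 0 \<or> x \<le> (1 - 4 / real h) * ln (real (card A)) - ln 2"
  obtains m and cw :: "nat \<Rightarrow> nat \<Rightarrow> 'a" where "0 < m" "exp (real L * x) \<le> real m"
    "\<And>v. v < m \<Longrightarrow> cw v \<in> PiE {..<L} (\<lambda>_. A)"
    "\<And>v v'. v < m \<Longrightarrow> v' < m \<Longrightarrow> v \<noteq> v' \<Longrightarrow> 4 * (L div h) < hdist L (cw v) (cw v')"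
proof (cases "x \<le> 0")
  case True
  obtain a where a: "a \<in> A" using A by blast
  show thesis
  proof (rule that[of 1 "\<lambda>_. restrict (\<lambda>_. a) {..<L}"])
    show "exp (real L * x) \<le> real 1" using True by (simp add: mult_nonneg_nonpos)
  qed (use a in auto)
next
  case False
  define q where "q = card A"
  define t where "t = 4 * (L div h)"
  have q: "1 \<le> q" using A by (simp add: q_def Suc_le_eq card_gt_0_iff)
  obtain C where C: "C \<subseteq> PiE {..<L} (\<lambda>_. A)"
    "\<And>x y. x \<in> C \<Longrightarrow> y \<in> C \<Longrightarrow> x \<noteq> y \<Longrightarrow> t < hdist L x y"
    "q ^ L \<le> card C * (2 ^ L * q ^ t)"
    unfolding q_def using gilbert_varshamov[OF A] by metis
  have finC: "finite C" using C(1) finite_PiE[of "{..<L}" "\<lambda>_. A"] A(1) finite_subset by blast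
  obtain cw where cw: "bij_betw cw {0..<card C} C" using ex_bij_betw_nat_finite[OF finC] by blast
  have "0 < card C" using C(3) q by (cases "card C") auto
  have t: "real t \<le> 4 / real h * real L"
  proof -
    have "real (L div h) \<le> real L / real h" by (rule of_nat_div_le_of_nat)
    thus ?thesis by (simp add: t_def)
  qed
  have "real L * x \<le> real L * ((1 - 4 / real h) * ln (real q) - ln 2)"
    using x False by (intro mult_left_mono) (auto simp: q_def)
  also have "\<dots> = real L * ln q - 4 / real h * real L * ln q - real L * ln 2"
    by (simp add: algebra_simps)
  also have "\<dots> \<le> real L * ln q - real t * ln q - real L * ln 2"
    using mult_right_mono[OF t, of "ln q"] q by simp
  also have "\<dots> \<le> ln (card C)"
  proof -
    have "real (q ^ L) \<le> real (card C * (2 ^ L * q ^ t))" using C(3) by (rule of_nat_mono)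
    hence "ln (real q ^ L) \<le> ln (real (card C) * (2 ^ L * real q ^ t))"
      using q \<open>0 < card C\<close> by (subst ln_le_cancel_iff) auto
    also have "\<dots> = ln (card C) + (ln (2 ^ L) + ln (real q ^ t))"
      using q \<open>0 < card C\<close> by (simp add: ln_mult)
    finally show ?thesis using q by (simp add: ln_realpow)
  qed
  finally have "exp (real L * x) \<le> exp (ln (card C))" by simp
  hence exp: "exp (real L * x) \<le> real (card C)" using \<open>0 < card C\<close> by simp
  show thesis
  proof (rule that[OF \<open>0 < card C\<close> exp])
    show "cw v \<in> PiE {..<L} (\<lambda>_. A)" if "v < card C" for v
      by (rule subsetD[OF C(1)]) (use bij_betwE[OF cw] that in simp)
    show "4 * (L div h) < hdist L (cw v) (cw v')" if "v < card C" "v' < card C" "v \<noteq> v'" for v v'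
    proof -
      have "cw v \<noteq> cw v'" using bij_betw_imp_inj_on[OF cw] that by (auto simp: inj_on_def)
      thus ?thesis using C(2)[of "cw v" "cw v'"] bij_betwE[OF cw] that by (auto simp: t_def)
    qed
  qed
qed

text \<open>In a good block only the transmitted letter passes the test. A codeword with at most
  \<open>e\<close> failures thus differs from the transmitted one only in bad blocks and in blocks
  where it fails, at most \<open>2 * e\<close> in all. The rule itself uses only \<open>ok\<close>,
  not \<open>bad\<close>.\<close>

lemma minimum_distance_decoding:
  fixes cw :: "nat \<Rightarrow> nat \<Rightarrow> 'a"
  assumes dist: "\<And>v. v < m \<Longrightarrow> v \<noteq> w \<Longrightarrow> 2 * e < hdist L (cw w) (cw v)" and w: "w < m"
    and bad: "card {l. l < L \<and> bad l} \<le> e"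
    and good: "\<And>l. l < L \<Longrightarrow> \<not> bad l \<Longrightarrow> ok l (cw w l)"
      "\<And>l v. l < L \<Longrightarrow> \<not> bad l \<Longrightarrow> v < m \<Longrightarrow> cw v l \<noteq> cw w l \<Longrightarrow> \<not> ok l (cw v l)"
  shows "(LEAST v. v < m \<and> card {l. l < L \<and> \<not> ok l (cw v l)} \<le> e) = w"
proof (rule Least_equality)
  have "card {l. l < L \<and> \<not> ok l (cw w l)} \<le> card {l. l < L \<and> bad l}"
    by (intro card_mono) (use good in auto)
  thus "w < m \<and> card {l. l < L \<and> \<not> ok l (cw w l)} \<le> e" using w bad by simp
next
  fix v assume v: "v < m \<and> card {l. l < L \<and> \<not> ok l (cw v l)} \<le> e"
  have "hdist L (cw w) (cw v) \<le> card ({l. l < L \<and> bad l} \<union> {l. l < L \<and> \<not> ok l (cw v l)})"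
    unfolding hdist_def by (intro card_mono) (use good(2) v in fastforce)+
  also have "\<dots> \<le> e + e" using card_Un_le[of "{l. l < L \<and> bad l}" "{l. l < L \<and> \<not> ok l (cw v l)}"] bad v by linarith
  finally have "v = w" using dist[of v] v by fastforce
  thus "w \<le> v" by simp
qed

section \<open>Probability of many bad samples\<close>

text \<open>Union bound over the \<open>n\<close>-element subsets of \<open>I\<close>: by
  independence, the cylinder on which a given subset falls into \<open>B\<close> has measure
  \<open>measure M B ^ n\<close>.\<close>

lemma prob_many_coordinates_le:
  fixes I :: "'i set"
  assumes M: "prob_space M" and I: "finite I" and B: "B \<in> sets M"
  obtains E where "E \<in> sets (PiM I (\<lambda>_. M))"
    "measure (PiM I (\<lambda>_. M)) E \<le> 2 ^ card I * measure M B ^ n"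
    "\<And>\<omega>. \<omega> \<in> space (PiM I (\<lambda>_. M)) - E \<Longrightarrow> card {i \<in> I. \<omega> i \<in> B} < n"
proof -
  interpret M: prob_space M by fact
  interpret P: finite_product_prob_space "\<lambda>_. M" I
    by unfold_locales (rule I)
  let ?P = "PiM I (\<lambda>_. M)"
  let ?E = "\<lambda>S. PiE I (\<lambda>i. if i \<in> S then B else space M)"
  let ?T = "{S. S \<subseteq> I \<and> card S = n}"
  have finT: "finite ?T" by (rule finite_subset[of _ "Pow I"]) (use I in auto)
  have E: "?E S \<in> sets ?P" for S using I B by (intro sets_PiM_I_finite) auto
  have sub: "{\<omega> \<in> space ?P. n \<le> card {i \<in> I. \<omega> i \<in> B}} \<subseteq> (\<Union>S\<in>?T. ?E S)"
  proof
    fix \<omega> assume w: "\<omega> \<in> {\<omega> \<in> space ?P. n \<le> card {i \<in> I. \<omega> i \<in> B}}"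
    then obtain S where S: "S \<subseteq> {i \<in> I. \<omega> i \<in> B}" "card S = n"
      by (auto elim: obtain_subset_with_card_n)
    thus "\<omega> \<in> (\<Union>S\<in>?T. ?E S)" using w
      by (intro UN_I[of S]) (auto simp: space_PiM PiE_iff)
  qed
  have "measure ?P (\<Union>S\<in>?T. ?E S) \<le> (\<Sum>S\<in>?T. measure ?P (?E S))"
    using E finT by (intro P.finite_measure_subadditive_finite) auto
  also have "\<dots> = (\<Sum>S\<in>?T. measure M B ^ n)"
  proof (rule sum.cong[OF refl])
    fix S assume S: "S \<in> ?T"
    have "measure ?P (?E S) = (\<Prod>i\<in>I. measure M (if i \<in> S then B else space M))"
      using B by (intro P.prob_times) auto
    also have "\<dots> = (\<Prod>i\<in>I. if i \<in> S then measure M B else 1)"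
      by (intro prod.cong) (auto simp: M.prob_space)
    also have "\<dots> = (\<Prod>i\<in>I \<inter> S. measure M B)" using I by (simp add: prod.If_cases Int_def)
    also have "I \<inter> S = S" using S by auto
    finally show "measure ?P (?E S) = measure M B ^ n" using S by simp
  qed
  also have "\<dots> = card ?T * measure M B ^ n" by simp
  also have "card ?T \<le> card (Pow I)" using I by (intro card_mono) auto
  hence "real (card ?T) * measure M B ^ n \<le> 2 ^ card I * measure M B ^ n"
    using I by (intro mult_right_mono) (auto simp: card_Pow)
  finally have le: "measure ?P (\<Union>S\<in>?T. ?E S) \<le> 2 ^ card I * measure M B ^ n" .
  show thesis
  proof (rule that[OF _ le])
    show "(\<Union>S\<in>?T. ?E S) \<in> sets ?P" using E finT by (intro sets.finite_UN) auto
    show "card {i \<in> I. \<omega> i \<in> B} < n" if "\<omega> \<in> space ?P - (\<Union>S\<in>?T. ?E S)" for \<omega>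
      using that sub by (metis (no_types, lifting) DiffE mem_Collect_eq not_le subsetD)
  qed
qed

text \<open>Continuity from above along the tail events, which decrease to the empty set. It
  supplies the cutoffs for the noise and for the conditioning of the channel.\<close>

lemma (in prob_space) prob_greater_small:
  fixes f :: "'a \<Rightarrow> real"
  assumes [measurable]: "f \<in> borel_measurable M" and p: "0 < p"
  obtains \<tau> :: real where "0 < \<tau>" "prob {x \<in> space M. \<tau> < f x} < p"
proof -
  let ?B = "\<lambda>n::nat. {x \<in> space M. real n < f x}"
  have "(\<lambda>n. prob (?B n)) \<longlonglongrightarrow> prob (\<Inter>n. ?B n)"
    by (rule finite_Lim_measure_decseq) (auto simp: decseq_def)
  also have "(\<Inter>n. ?B n) = {}"
  proof -
    have "\<exists>n::nat. \<not> real n < f x" for x using real_arch_simple[of "f x"] by (auto simp: not_less)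
    thus ?thesis by blast
  qed
  finally have "eventually (\<lambda>n. prob (?B n) < p) sequentially"
    using p by (auto intro: order_tendstoD)
  hence "eventually (\<lambda>n. prob (?B n) < p \<and> 0 < n) sequentially"
    using eventually_gt_at_top[of 0] by eventually_elim simp
  then obtain n where "prob (?B n) < p" "0 < n"
    using eventually_happens' [OF sequentially_bot] by blast
  thus thesis using that[of "real n"] by simp
qed

lemma sets_CN01 [measurable_cong]: "sets CN01 = sets borel"
  by (simp add: CN01_def)

text \<open>The density factors over real and imaginary part into Gaussians of variance
  \<open>1/2\<close>, each with integral \<open>sqrt pi\<close> before normalisation.\<close>

lemma prob_space_CN01: "prob_space CN01"
proof
  let ?g = "\<lambda>x::real. ennreal (exp (- x\<^sup>2))"
  have gauss: "(\<integral>\<^sup>+x. ?g x \<partial>lborel) = ennreal (sqrt pi)"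
  proof -
    have "(\<integral>\<^sup>+x. ?g x \<partial>lborel) = (\<integral>\<^sup>+x. ennreal (sqrt pi) * ennreal (normal_density 0 (sqrt (1/2)) x) \<partial>lborel)"
      by (intro nn_integral_cong) (simp add: normal_density_def real_sqrt_divide power_divide ennreal_mult[symmetric])
    also have "\<dots> = ennreal (sqrt pi) * (\<integral>\<^sup>+x. ennreal (normal_density 0 (sqrt (1/2)) x) \<partial>lborel)"
      by (rule nn_integral_cmult) simp
    also have "(\<integral>\<^sup>+x. ennreal (normal_density 0 (sqrt (1/2)) x) \<partial>lborel) = 1"
      by (subst nn_integral_eq_integral) (simp_all add: integral_normal_density)
    finally show ?thesis by simp
  qed
  have "emeasure CN01 (space CN01) = (\<integral>\<^sup>+z. ennreal (exp (- (cmod z)\<^sup>2) / pi) \<partial>lborel)"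
    by (simp add: CN01_def emeasure_density)
  also have "\<dots> = (\<integral>\<^sup>+z. ennreal (1 / pi) * (\<Prod>b\<in>Basis. ?g (z \<bullet> b)) \<partial>(lborel :: complex measure))"
  proof (intro nn_integral_cong)
    fix z :: complex
    have "(\<Prod>b\<in>Basis. ?g (z \<bullet> b)) = ?g (Re z) * ?g (Im z)"
      by (simp add: Basis_complex_def)
    also have "\<dots> = ennreal (exp (- (cmod z)\<^sup>2))"
      by (simp add: ennreal_mult[symmetric] exp_add[symmetric] cmod_power2)
    finally show "ennreal (exp (- (cmod z)\<^sup>2) / pi) = ennreal (1 / pi) * (\<Prod>b\<in>Basis. ?g (z \<bullet> b))"
      by (simp add: ennreal_mult[symmetric])
  qed
  also have "\<dots> = ennreal (1 / pi) * (\<integral>\<^sup>+z. (\<Prod>b\<in>Basis. ?g (z \<bullet> b)) \<partial>(lborel :: complex measure))"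
    by (rule nn_integral_cmult) measurable
  also have "(\<integral>\<^sup>+z. (\<Prod>b\<in>Basis. ?g (z \<bullet> b)) \<partial>(lborel :: complex measure)) = (\<Prod>b\<in>(Basis::complex set). ennreal (sqrt pi))"
    by (subst nn_integral_lborel_prod) (simp_all add: gauss)
  also have "\<dots> = ennreal pi"
    by (simp add: Basis_complex_def ennreal_mult[symmetric])
  finally show "emeasure CN01 (space CN01) = 1"
    by (simp add: ennreal_mult[symmetric])
qed

lemma measure_pair_prob_Times:
  assumes "prob_space P" "prob_space P'" "A \<in> sets P" "B \<in> sets P'"
  shows "measure (P \<Otimes>\<^sub>M P') (A \<times> B) = measure P A * measure P' B"
proof -
  interpret P: prob_space P by fact
  interpret P': prob_space P' by fact
  show ?thesis using P'.emeasure_pair_measure_Times[OF assms(3,4)]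
    by (simp add: measure_def enn2real_mult)
qed

text \<open>The bound on the probability of a bad fading realisation or noise sample is chosen to beat the
  at most \<open>2 ^ (L * T * N)\<close> subsets in the union bound by the factor \<open>2 ^ L\<close>.\<close>

lemma bad_block_event:
  fixes B :: "(nat \<times> nat \<Rightarrow> complex) set" and Bw :: "complex set"
  assumes P: "prob_space P" and B: "B \<in> sets P" and Bw: "Bw \<in> sets CN01"
    and h: "0 < h" and TN: "0 < T" "0 < N"
    and p: "measure P B \<le> (1 / 2 ^ (T * N + 1)) ^ h" "measure CN01 Bw \<le> (1 / 2 ^ (T * N + 1)) ^ h"
  obtains E where "E \<in> sets (user_space P N T L)" "measure (user_space P N T L) E \<le> 2 * (1 / 2) ^ L"
    "\<And>\<omega>. \<omega> \<in> space (user_space P N T L) - E \<Longrightarrow>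
       card {l. l < L \<and> (fst \<omega> l \<in> B \<or> (\<exists>t<T. \<exists>a<N. snd \<omega> (l * T + t, a) \<in> Bw))} \<le> 2 * (L div h)"
proof -
  \<comment> \<open>Fewer than \<open>n\<close> bad coordinates means at most
    \<open>L div h\<close>, while \<open>h * n \<ge> L\<close> turns the \<open>h\<close>-th powers
    in the assumptions into at least \<open>L\<close>-th powers.\<close>
  define n where "n = L div h + 1"
  have nh: "L \<le> h * n" using h unfolding n_def
    by (metis Suc_eq_plus1 dividend_less_times_div less_imp_le_nat mult_Suc_right add.commute)
  have bound: "2 ^ i * x ^ n \<le> (1 / 2) ^ L"
    if "i \<le> L * (T * N)" "0 \<le> x" "x \<le> (1 / 2 ^ (T * N + 1)) ^ h" for i and x :: real
  proof -
    have "x ^ n \<le> ((1 / 2 ^ (T * N + 1)) ^ h) ^ n" using that by (intro power_mono)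
    also have "\<dots> = (1 / 2 ^ (T * N + 1)) ^ (h * n)" by (simp only: power_mult)
    also have "\<dots> \<le> (1 / 2 ^ (T * N + 1)) ^ L"
      using nh one_le_power[of "2 :: real" "T * N + 1"] by (intro power_decreasing) auto
    finally have "x ^ n \<le> (1 / 2 ^ (T * N + 1)) ^ L" .
    moreover have "(2 :: real) ^ i \<le> 2 ^ (L * (T * N))" using that by (intro power_increasing) auto
    ultimately have "2 ^ i * x ^ n \<le> 2 ^ (L * (T * N)) * (1 / 2 ^ (T * N + 1)) ^ L"
      using that by (intro mult_mono) auto
    also have "\<dots> = (2 ^ (T * N) * (1 / 2 ^ (T * N + 1))) ^ L"
      by (simp only: power_mult_distrib power_mult[symmetric] mult.commute[of L])
    also have "2 ^ (T * N) * (1 / 2 ^ (T * N + 1)) = (1 / 2 :: real)" by simp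
    finally show ?thesis .
  qed
  let ?PG = "PiM {..<L} (\<lambda>_. P)" and ?I = "{..<L*T} \<times> {..<N}"
  let ?PW = "PiM ?I (\<lambda>_. CN01)"
  have probs: "prob_space ?PG" "prob_space ?PW"
    using P prob_space_CN01 by (auto intro!: prob_space_PiM)
  obtain EG where EG: "EG \<in> sets ?PG" "measure ?PG EG \<le> 2 ^ card {..<L} * measure P B ^ n"
    "\<And>\<omega>. \<omega> \<in> space ?PG - EG \<Longrightarrow> card {i \<in> {..<L}. \<omega> i \<in> B} < n"
    using prob_many_coordinates_le[OF P _ B, of "{..<L}" n] by blast
  obtain EW where EW: "EW \<in> sets ?PW" "measure ?PW EW \<le> 2 ^ card ?I * measure CN01 Bw ^ n"
    "\<And>\<omega>. \<omega> \<in> space ?PW - EW \<Longrightarrow> card {i \<in> ?I. \<omega> i \<in> Bw} < n"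
    using prob_many_coordinates_le[OF prob_space_CN01 _ Bw, of ?I n] by blast
  have "L * 1 \<le> L * (T * N)" using TN by (intro mult_left_mono) (auto simp: Suc_le_eq)
  hence G: "measure ?PG EG \<le> (1 / 2) ^ L"
    using EG(2) bound[of "card {..<L}" "measure P B"] p(1) by simp
  have W: "measure ?PW EW \<le> (1 / 2) ^ L"
    using EW(2) bound[of "card ?I" "measure CN01 Bw"] p(2) by (simp add: mult.assoc)
  define E where "E = EG \<times> space ?PW \<union> space ?PG \<times> EW"
  have sets: "EG \<times> space ?PW \<in> sets (?PG \<Otimes>\<^sub>M ?PW)" "space ?PG \<times> EW \<in> sets (?PG \<Otimes>\<^sub>M ?PW)"
    using EG(1) EW(1) by auto
  show thesis
  proof (rule that[of E])
    show "E \<in> sets (user_space P N T L)" using sets by (auto simp: E_def user_space_def)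
    have "measure (user_space P N T L) E \<le> measure ?PG EG * measure ?PW (space ?PW) + measure ?PG (space ?PG) * measure ?PW EW"
      unfolding E_def user_space_def using EG(1) EW(1)
      by (intro order.trans[OF measure_Un_le[OF sets]]) (simp add: measure_pair_prob_Times[OF probs])
    also have "\<dots> \<le> 2 * (1 / 2) ^ L"
      using G W by (simp add: prob_space.prob_space[OF probs(1)] prob_space.prob_space[OF probs(2)])
    finally show "measure (user_space P N T L) E \<le> 2 * (1 / 2) ^ L" .
  next
    fix \<omega> assume w: "\<omega> \<in> space (user_space P N T L) - E"
    hence w1: "fst \<omega> \<in> space ?PG - EG" and w2: "snd \<omega> \<in> space ?PW - EW"
      by (auto simp: E_def user_space_def space_pair_measure)
    let ?BG = "{i \<in> {..<L}. fst \<omega> i \<in> B}" and ?BW = "{i \<in> ?I. snd \<omega> i \<in> Bw}"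
    have finW: "finite ?BW" by (rule finite_subset[of _ ?I]) auto
    \<comment> \<open>A bad noise sample at time \<open>j\<close> spoils only the block
      \<open>j div T\<close>, so bad blocks are at most as many as bad fading realisations and bad
      noise samples together.\<close>
    have "{l. l < L \<and> (fst \<omega> l \<in> B \<or> (\<exists>t<T. \<exists>a<N. snd \<omega> (l * T + t, a) \<in> Bw))}
            \<subseteq> ?BG \<union> (\<lambda>(j, a). j div T) ` ?BW"
    proof -
      have "l \<in> (\<lambda>(j, a). j div T) ` ?BW"
        if l: "l < L" "t < T" "a < N" "snd \<omega> (l * T + t, a) \<in> Bw" for l t a
      proof -
        have "l * T + t < (l + 1) * T" using l by simp
        also have "\<dots> \<le> L * T" using l by (intro mult_right_mono) auto
        finally have "(l * T + t, a) \<in> ?BW" using l by simp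
        moreover have "(l * T + t) div T = l" using l by simp
        ultimately show ?thesis by (intro image_eqI[of _ _ "(l * T + t, a)"]) simp_all
      qed
      thus ?thesis by fastforce
    qed
    hence "card {l. l < L \<and> (fst \<omega> l \<in> B \<or> (\<exists>t<T. \<exists>a<N. snd \<omega> (l * T + t, a) \<in> Bw))}
        \<le> card (?BG \<union> (\<lambda>(j, a). j div T) ` ?BW)"
      using finW by (intro card_mono) auto
    also have "\<dots> \<le> card ?BG + card ((\<lambda>(j, a). j div T) ` ?BW)" by (rule card_Un_le)
    also have "\<dots> \<le> card ?BG + card ?BW" using card_image_le[OF finW] by simp
    also have "\<dots> \<le> 2 * (L div h)" using EG(3)[OF w1] EW(3)[OF w2] by (simp add: n_def)
    finally show "card {l. l < L \<and> (fst \<omega> l \<in> B \<or> (\<exists>t<T. \<exists>a<N. snd \<omega> (l * T + t, a) \<in> Bw))} \<le> 2 * (L div h)" .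
  qed
qed

section \<open>Conditioning of random matrices\<close>

lemma borel_measurable_det:
  fixes f :: "nat \<Rightarrow> nat \<Rightarrow> 'x \<Rightarrow> complex"
  assumes "\<And>i j. i < n \<Longrightarrow> j < n \<Longrightarrow> f i j \<in> borel_measurable M"
  shows "(\<lambda>x. det (mat n n (\<lambda>(i, j). f i j x))) \<in> borel_measurable M"
proof -
  have "det (mat n n (\<lambda>(i, j). f i j x)) =
      (\<Sum>p\<in>{p. p permutes {0..<n}}. signof p * (\<Prod>i = 0..<n. f i (p i) x))" for x
  proof -
    have "mat n n (\<lambda>(i, j). f i j x) $$ (i, p i) = f i (p i) x"
      if "p permutes {0..<n}" "i \<in> {0..<n}" for i p
      using that permutes_in_image[of p "{0..<n}" i] by auto
    thus ?thesis
      by (subst det_def'[of _ n]) (auto intro!: sum.cong prod.cong)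
  qed
  moreover have "(\<lambda>x. \<Sum>p\<in>{p. p permutes {0..<n}}. signof p * (\<Prod>i = 0..<n. f i (p i) x)) \<in> borel_measurable M"
  proof (intro borel_measurable_sum borel_measurable_times borel_measurable_prod borel_measurable_const assms)
    fix p i assume "p \<in> {p. p permutes {0..<n}}" "i \<in> {0..<n}"
    thus "i < n" "p i < n" using permutes_in_image[of p "{0..<n}" i] by auto
  qed
  ultimately show ?thesis by simp
qed

lemma borel_measurable_cofactor:
  fixes f :: "nat \<Rightarrow> nat \<Rightarrow> 'x \<Rightarrow> complex"
  assumes f: "\<And>i j. i < n \<Longrightarrow> j < n \<Longrightarrow> f i j \<in> borel_measurable M" and ab: "a < n" "b < n"
  shows "(\<lambda>x. cofactor (mat n n (\<lambda>(i, j). f i j x)) a b) \<in> borel_measurable M"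
proof -
  have "mat_delete (mat n n (\<lambda>(i, j). f i j x)) a b =
      mat (n - 1) (n - 1) (\<lambda>(i, j). f (if i < a then i else Suc i) (if j < b then j else Suc j) x)" for x
    using ab by (intro eq_matI) (auto simp: mat_delete_def)
  moreover have "(\<lambda>x. det (mat (n - 1) (n - 1) (\<lambda>(i, j). f (if i < a then i else Suc i) (if j < b then j else Suc j) x)))
      \<in> borel_measurable M"
    by (intro borel_measurable_det f) auto
  ultimately show ?thesis by (simp add: cofactor_def)
qed

text \<open>Tonelli: with coordinate \<open>i\<close> integrated first, almost every slice of the
  exceptional set is null.\<close>

lemma AE_PiM_insertI:
  fixes M :: "'i \<Rightarrow> 'x measure"
  assumes sf: "product_sigma_finite M" and I: "finite I" "i \<notin> I"
    and P: "{x \<in> space (PiM (insert i I) M). \<not> P x} \<in> sets (PiM (insert i I) M)"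
    and AE: "AE x in PiM I M. AE y in M i. P (x(i := y))"
  shows "AE x in PiM (insert i I) M. P x"
proof -
  interpret product_sigma_finite M by fact
  let ?N = "{x \<in> space (PiM (insert i I) M). \<not> P x}"
  have "emeasure (PiM (insert i I) M) ?N = (\<integral>\<^sup>+x. indicator ?N x \<partial>PiM (insert i I) M)"
    using P by simp
  also have "\<dots> = (\<integral>\<^sup>+x. (\<integral>\<^sup>+y. indicator ?N (x(i := y)) \<partial>M i) \<partial>PiM I M)"
    using P by (intro product_nn_integral_insert I) simp
  also have "\<dots> = (\<integral>\<^sup>+x. 0 \<partial>PiM I M)"
  proof (rule nn_integral_cong_AE)
    show "AE x in PiM I M. (\<integral>\<^sup>+y. indicator ?N (x(i := y)) \<partial>M i) = 0"
      using AE
    proof eventually_elim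
      case (elim x)
      have "(\<integral>\<^sup>+y. indicator ?N (x(i := y)) \<partial>M i) = (\<integral>\<^sup>+y. 0 \<partial>M i)"
        using elim by (intro nn_integral_cong_AE) (auto split: split_indicator)
      thus ?case by simp
    qed
  qed
  finally have "emeasure (PiM (insert i I) M) ?N = 0" by simp
  with P show ?thesis by (intro AE_I[of _ _ ?N]) auto
qed

text \<open>The determinant is affine in the bottom right entry, with the leading minor as slope, so
  the exceptional values of that entry form a null set once the minor is nonzero.\<close>

lemma AE_det_nonzero:
  fixes \<sigma> :: "nat \<Rightarrow> complex" and h :: "nat \<Rightarrow> nat"
  assumes "\<And>b. b < n \<Longrightarrow> \<sigma> b \<noteq> 0" "inj_on h {..<n}"
    and "finite I" "\<And>a b. a < n \<Longrightarrow> b < n \<Longrightarrow> (a, h b) \<in> I"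
  shows "AE G in PiM I (\<lambda>_. lborel). det (mat n n (\<lambda>(a, b). G (a, h b) * \<sigma> b)) \<noteq> 0"
  using assms
proof (induction n arbitrary: I)
  case 0
  thus ?case by (simp add: det_def)
next
  case (Suc n)
  define i where "i = (n, h n)"
  define J where "J = I - {i}"
  have iI: "i \<in> I" using Suc.prems(4)[of n n] by (simp add: i_def)
  hence I: "I = insert i J" "i \<notin> J" "finite J" using Suc.prems(3) by (auto simp: J_def)
  \<comment> \<open>Injectivity of \<open>h\<close> keeps the varied coordinate \<open>i\<close> out
    of all other entries of the last row.\<close>
  have hn: "h b \<noteq> h n" if "b < n" for b
    using inj_onD[OF Suc.prems(2), of b n] that by auto
  let ?D = "\<lambda>n G. det (mat n n (\<lambda>(a, b). G (a, h b) * \<sigma> b))"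
  have IH: "AE G in PiM J (\<lambda>_. lborel). ?D n G \<noteq> 0"
  proof (rule Suc.IH)
    show "inj_on h {..<n}" by (rule inj_on_subset[OF Suc.prems(2)]) auto
    show "(a, h b) \<in> J" if "a < n" "b < n" for a b
      using Suc.prems(4)[of a b] that by (simp add: J_def i_def)
  qed (use Suc.prems I in auto)
  have meas: "?D (Suc n) \<in> borel_measurable (PiM I (\<lambda>_. lborel))"
  proof (intro borel_measurable_det borel_measurable_times borel_measurable_const)
    fix a b assume "a < Suc n" "b < Suc n"
    from measurable_component_singleton[OF Suc.prems(4)[OF this], of "\<lambda>_. lborel"]
    show "(\<lambda>G. G (a, h b)) \<in> borel_measurable (PiM I (\<lambda>_. lborel))" by simp
  qed
  show ?case unfolding I(1)
  proof (rule AE_PiM_insertI)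
    show "product_sigma_finite (\<lambda>_. lborel :: complex measure)"
      by unfold_locales
    show "{G \<in> space (PiM (insert i J) (\<lambda>_. lborel)). \<not> ?D (Suc n) G \<noteq> 0} \<in> sets (PiM (insert i J) (\<lambda>_. lborel))"
      using meas unfolding I(1) by measurable
    show "AE G in PiM J (\<lambda>_. lborel). AE y in lborel. ?D (Suc n) (G(i := y)) \<noteq> 0"
      using IH
    proof eventually_elim
      case (elim G)
      let ?A = "\<lambda>y. mat (Suc n) (Suc n) (\<lambda>(a, b). (G(i := y)) (a, h b) * \<sigma> b)"
      let ?B = "mat (Suc n) (Suc n) (\<lambda>(a, b). G (a, h b) * \<sigma> b)"
      have cof: "cofactor (?A y) n j = cofactor ?B n j" if "j < Suc n" for y j
      proof -
        have "mat_delete (?A y) n j = mat_delete ?B n j"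
          by (intro eq_matI) (auto simp: mat_delete_def i_def)
        thus ?thesis by (simp add: cofactor_def)
      qed
      have cofn: "cofactor ?B n n = ?D n G"
      proof -
        have "mat_delete ?B n n = mat n n (\<lambda>(a, b). G (a, h b) * \<sigma> b)"
          by (intro eq_matI) (auto simp: mat_delete_def)
        thus ?thesis by (simp add: cofactor_def)
      qed
      define c where "c = (\<Sum>j<n. G (n, h j) * \<sigma> j * cofactor ?B n j)"
      have exp: "?D (Suc n) (G(i := y)) = c + y * \<sigma> n * ?D n G" for y
      proof -
        have "?D (Suc n) (G(i := y)) = (\<Sum>j<Suc n. ?A y $$ (n, j) * cofactor (?A y) n j)"
          by (rule laplace_expansion_row) auto
        also have "\<dots> = (\<Sum>j<Suc n. ?A y $$ (n, j) * cofactor ?B n j)"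
          by (intro sum.cong refl) (simp only: cof lessThan_iff)
        also have "\<dots> = (\<Sum>j<n. ?A y $$ (n, j) * cofactor ?B n j) + y * \<sigma> n * ?D n G"
          by (simp add: i_def cofn)
        also have "(\<Sum>j<n. ?A y $$ (n, j) * cofactor ?B n j) = c"
          unfolding c_def using hn by (intro sum.cong) (auto simp: i_def)
        finally show ?thesis .
      qed
      have s: "\<sigma> n * ?D n G \<noteq> 0" using elim Suc.prems(1)[of n] by simp
      show ?case
        using AE_lborel_singleton[of "- c / (\<sigma> n * ?D n G)"]
      proof eventually_elim
        case (elim y)
        show ?case
        proof
          assume "?D (Suc n) (G(i := y)) = 0"
          hence "y * (\<sigma> n * ?D n G) = - c" unfolding exp by (simp add: algebra_simps eq_neg_iff_add_eq_0)
          hence "y = - c / (\<sigma> n * ?D n G)" by (rule eq_divide_imp[OF s])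
          with elim show False by simp
        qed
      qed
    qed
  qed (use I in auto)
qed

text \<open>Multiplying by the adjugate turns \<open>A u\<close> into the determinant times
  \<open>u\<close>. Summing the moduli of all cofactors, not just of those for one index, gives a
  factor that is the same for every \<open>b\<close>.\<close>

lemma cramer_bound:
  fixes A :: "nat \<Rightarrow> nat \<Rightarrow> complex" and n :: nat
  defines "A' \<equiv> mat n n (\<lambda>(i, j). A i j)"
  assumes det: "det A' \<noteq> 0" and x: "\<And>a. a < n \<Longrightarrow> cmod (\<Sum>c<n. A a c * u c) \<le> x" and b: "b < n"
  shows "cmod (u b) \<le> (\<Sum>i<n. \<Sum>j<n. cmod (cofactor A' j i)) / cmod (det A') * x"
proof -
  have A': "A' \<in> carrier_mat n n" by (simp add: A'_def)
  have inv: "(\<Sum>a<n. cofactor A' a b * A a c) = (if b = c then det A' else 0)" if "c < n" for c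
  proof -
    have "(adj_mat A' * A') $$ (b, c) = (\<Sum>a<n. cofactor A' a b * A a c)"
      using b that by (simp add: adj_mat_def A'_def scalar_prod_def lessThan_atLeast0)
    thus ?thesis using b that by (auto simp: adj_mat(3)[OF A'] split: if_splits)
  qed
  have "det A' * u b = (\<Sum>c<n. (if b = c then det A' else 0) * u c)"
    using b by (simp add: if_distrib[of "\<lambda>z. z * _"] cong: if_cong)
  also have "\<dots> = (\<Sum>c<n. \<Sum>a<n. cofactor A' a b * A a c * u c)"
    by (intro sum.cong refl) (simp add: inv[symmetric] sum_distrib_right)
  also have "\<dots> = (\<Sum>a<n. cofactor A' a b * (\<Sum>c<n. A a c * u c))"
    by (subst sum.swap) (simp add: sum_distrib_left mult.assoc)
  finally have "cmod (det A') * cmod (u b) = cmod (\<Sum>a<n. cofactor A' a b * (\<Sum>c<n. A a c * u c))"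
    by (metis norm_mult)
  also have "\<dots> \<le> (\<Sum>a<n. cmod (cofactor A' a b) * x)"
    by (intro sum_norm_le) (simp add: norm_mult x mult_left_mono)
  also have "\<dots> = (\<Sum>a<n. cmod (cofactor A' a b)) * x" by (simp add: sum_distrib_right)
  also have "\<dots> \<le> (\<Sum>i<n. \<Sum>j<n. cmod (cofactor A' j i)) * x"
  proof (rule mult_right_mono)
    show "(\<Sum>a<n. cmod (cofactor A' a b)) \<le> (\<Sum>i<n. \<Sum>j<n. cmod (cofactor A' j i))"
      using b by (intro member_le_sum[of b _ "\<lambda>i. \<Sum>j<n. cmod (cofactor A' j i)"]) (auto intro: sum_nonneg)
    show "0 \<le> x" using x[OF b] norm_ge_zero order_trans by blast
  qed
  finally show ?thesis using det by (simp add: field_simps)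
qed

text \<open>Since \<open>P\<close> has a density, the selected square block is almost surely
  invertible. The factor in \<open>cramer_bound\<close> is a real random variable, hence below some
  constant outside an event of small probability.\<close>

lemma well_conditioned_event:
  fixes P :: "(nat \<times> nat \<Rightarrow> complex) measure" and \<sigma> :: "nat \<Rightarrow> complex"
  assumes "prob_space P" and ent: "diff_entropy_gt_minf P N r"
    and n: "n \<le> N" and h: "inj_on h {..<n}" "\<And>b. b < n \<Longrightarrow> h b < r"
    and \<sigma>: "\<And>b. b < n \<Longrightarrow> \<sigma> b \<noteq> 0" and p: "0 < p"
  obtains \<tau> B where "0 < \<tau>" "B \<in> sets P" "measure P B < p"
    "\<And>G u x b. G \<in> space P - B \<Longrightarrow> (\<And>a. a < n \<Longrightarrow> cmod (\<Sum>c<n. G (a, h c) * \<sigma> c * u c) \<le> x)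
       \<Longrightarrow> b < n \<Longrightarrow> cmod (u b) \<le> \<tau> * x"
proof -
  interpret prob_space P by fact
  obtain f where f: "f \<in> borel_measurable (Gleb N r)"
    and P: "P = density (Gleb N r) (\<lambda>x. ennreal (f x))"
    using ent by (auto simp: diff_entropy_gt_minf_def)
  let ?A = "\<lambda>G. mat n n (\<lambda>(a, b). G (a, h b) * \<sigma> b)"
  have comp: "(\<lambda>G. G (a, h b) * \<sigma> b) \<in> borel_measurable P" if "a < n" "b < n" for a b
  proof -
    have "(a, h b) \<in> {..<N} \<times> {..<r}" using that n h(2)[of b] by simp
    from measurable_component_singleton[OF this, of "\<lambda>_. lborel"]
    show ?thesis
      by (intro borel_measurable_times borel_measurable_const) (simp add: P Gleb_def)
  qed
  have det [measurable]: "(\<lambda>G. det (?A G)) \<in> borel_measurable P"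
    by (rule borel_measurable_det) (rule comp)
  define c where "c G = (\<Sum>i<n. \<Sum>j<n. cmod (cofactor (?A G) j i)) / cmod (det (?A G))" for G
  have c [measurable]: "c \<in> borel_measurable P"
    unfolding c_def
    by (intro borel_measurable_divide borel_measurable_sum measurable_compose[OF _ borel_measurable_norm]
        borel_measurable_cofactor det comp) auto
  have "AE G in Gleb N r. det (?A G) \<noteq> 0"
    unfolding Gleb_def using n h \<sigma> by (intro AE_det_nonzero) auto
  hence "AE G in P. det (?A G) \<noteq> 0"
    unfolding P using f by (subst AE_density) auto
  hence null: "prob {G \<in> space P. det (?A G) = 0} = 0"
    by (intro prob_eq_0_AE[OF _]) auto
  obtain \<tau> where \<tau>: "0 < \<tau>" "prob {G \<in> space P. \<tau> < c G} < p"
    using prob_greater_small[OF c p] .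
  \<comment> \<open>Singular matrices are removed separately: there division by zero gives
    \<open>c G = 0\<close>, so the cutoff alone would accept them.\<close>
  define B where "B = {G \<in> space P. \<tau> < c G} \<union> {G \<in> space P. det (?A G) = 0}"
  show thesis
  proof (rule that)
    show "0 < \<tau>" by fact
    show "B \<in> sets P" unfolding B_def by measurable
    have "prob B \<le> prob {G \<in> space P. \<tau> < c G} + prob {G \<in> space P. det (?A G) = 0}"
      unfolding B_def by (intro measure_Un_le) measurable
    with null \<tau>(2) show "prob B < p" by simp
  next
    fix G u x b
    assume G: "G \<in> space P - B" and x: "\<And>a. a < n \<Longrightarrow> cmod (\<Sum>c<n. G (a, h c) * \<sigma> c * u c) \<le> x" and b: "b < n"
    from G have "det (?A G) \<noteq> 0" "c G \<le> \<tau>" by (auto simp: B_def not_less)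
    have "cmod (u b) \<le> c G * x"
      unfolding c_def by (rule cramer_bound) (use \<open>det (?A G) \<noteq> 0\<close> x b in auto)
    also have "\<dots> \<le> \<tau> * x"
      using \<open>c G \<le> \<tau>\<close> x[OF b] norm_ge_zero order_trans by (intro mult_right_mono) blast+
    finally show "cmod (u b) \<le> \<tau> * x" .
  qed
qed

section \<open>Product superposition within a block\<close>

text \<open>As a matrix this is the inverse of \<open>I - S\<close>, with \<open>S\<close> the
  strictly upper triangular part of \<open>D\<close>. Column \<open>t\<close> is the signal of slot
  \<open>t\<close> and row \<open>c\<close> its component in coordinate \<open>c\<close>. Only
  earlier slots are combined, so the matrix is unit upper triangular for any
  \<open>D\<close>.\<close>

fun precoder :: "(nat \<Rightarrow> nat \<Rightarrow> complex) \<Rightarrow> nat \<Rightarrow> nat \<Rightarrow> complex" where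
  "precoder D c t = (if c = t then 1 else 0) + (\<Sum>c'<t. precoder D c c' * D c' t)"

declare precoder.simps [simp del]

lemma precoder_below_diagonal: "t < c \<Longrightarrow> precoder D c t = 0"
proof (induction t rule: less_induct)
  case (less t)
  thus ?case by (subst precoder.simps) (auto intro!: sum.neutral)
qed

lemma precoder_diagonal: "precoder D t t = 1"
  by (subst precoder.simps) (simp add: precoder_below_diagonal)

text \<open>Off coordinate \<open>t\<close> the pilot of slot \<open>t\<close> vanishes, and what
  remains combines the first \<open>n\<close> slots with the data of slot \<open>t\<close> as
  coefficients.\<close>

lemma precoder_off_diagonal:
  assumes "c < t" "n \<le> t" "\<And>c'. n \<le> c' \<Longrightarrow> D c' t = 0"
  shows "precoder D c t = (\<Sum>c'<n. precoder D c c' * D c' t)"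
proof -
  have "precoder D c t = (\<Sum>c'<t. precoder D c c' * D c' t)"
    using assms(1) by (subst precoder.simps) simp
  also have "\<dots> = (\<Sum>c'<n. precoder D c c' * D c' t)"
    using assms(2,3) by (intro sum.mono_neutral_right) auto
  finally show ?thesis .
qed

text \<open>Column \<open>t\<close> adds at most \<open>n\<close> earlier columns with coefficients
  of modulus at most \<open>2\<close>, so each slot costs a factor \<open>1 + 2 * n\<close>. The
  bound does not depend on data or SNR, as the power constraint requires.\<close>

lemma cmod_precoder_le:
  assumes "\<And>c t. cmod (D c t) \<le> 2"
  shows "t \<le> n \<Longrightarrow> cmod (precoder D c t) \<le> (1 + 2 * real n) ^ t"
proof (induction t rule: less_induct)
  case (less t)
  have "cmod (precoder D c t) \<le> cmod (if c = t then 1 else 0) + (\<Sum>c'<t. cmod (precoder D c c' * D c' t))"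
    by (subst precoder.simps) (intro order.trans[OF norm_triangle_ineq] add_left_mono norm_sum)
  also have "\<dots> \<le> (1 + 2 * real n) ^ t"
  proof (cases t)
    case 0
    thus ?thesis by simp
  next
    case (Suc k)
    have "cmod (precoder D c c' * D c' t) \<le> (1 + 2 * real n) ^ k * 2" if "c' < t" for c'
    proof -
      have "cmod (precoder D c c') \<le> (1 + 2 * real n) ^ c'" using that less by simp
      also have "\<dots> \<le> (1 + 2 * real n) ^ k" using that Suc by (intro power_increasing) auto
      finally show ?thesis unfolding norm_mult by (intro mult_mono assms) auto
    qed
    hence "(\<Sum>c'<t. cmod (precoder D c c' * D c' t)) \<le> (\<Sum>c'<t. (1 + 2 * real n) ^ k * 2)"
      by (intro sum_mono) simp
    also have "\<dots> = real t * ((1 + 2 * real n) ^ k * 2)" by simp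
    also have "\<dots> \<le> real n * ((1 + 2 * real n) ^ k * 2)"
      using less.prems by (intro mult_right_mono) auto
    finally have "(\<Sum>c'<t. cmod (precoder D c c' * D c' t)) \<le> real n * ((1 + 2 * real n) ^ k * 2)" .
    moreover have "cmod (if c = t then 1 else 0) \<le> (1 + 2 * real n) ^ k"
      by (auto intro: one_le_power)
    ultimately show ?thesis by (simp add: Suc algebra_simps)
  qed
  finally show ?case .
qed

text \<open>At the last nonzero coordinate of \<open>v\<close>, a unit upper triangular matrix leaves \<open>v\<close> unchanged.\<close>

lemma precoder_expands:
  assumes "i0 < n" "v i0 \<noteq> 0" and min: "\<And>i. i < n \<Longrightarrow> v i \<noteq> 0 \<Longrightarrow> \<Delta> \<le> cmod (v i)"
  obtains i where "i < n" "\<Delta> \<le> cmod (\<Sum>c'<n. precoder D i c' * v c')"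
proof -
  define S where "S = {i. i < n \<and> v i \<noteq> 0}"
  define i where "i = Max S"
  have S: "finite S" "S \<noteq> {}" using assms by (auto simp: S_def)
  hence i: "i \<in> S" unfolding i_def by (rule Max_in)
  have z: "v c' = 0" if "c' < n" "i < c'" for c'
    using that Max_ge[OF S(1), of c'] unfolding i_def[symmetric] by (auto simp: S_def)
  have "(\<Sum>c'<n. precoder D i c' * v c') = (\<Sum>c'\<in>{i}. precoder D i c' * v c')"
  proof (rule sum.mono_neutral_right)
    show "\<forall>c'\<in>{..<n} - {i}. precoder D i c' * v c' = 0"
    proof
      fix c' assume "c' \<in> {..<n} - {i}"
      thus "precoder D i c' * v c' = 0"
        using z[of c'] precoder_below_diagonal[of c' i D] by (cases "c' < i") auto
    qed
  qed (use i in \<open>auto simp: S_def\<close>)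
  also have "\<dots> = v i" by (simp add: precoder_diagonal)
  finally show thesis using that[of i] i min[of i] by (simp add: S_def)
qed

text \<open>What remains of slot \<open>t\<close> after the prediction from the pilot slots under
  hypothetical symbols \<open>e\<close>. It is computed from observations alone, without a channel
  estimate.\<close>

definition residual :: "nat \<Rightarrow> (nat \<Rightarrow> complex) \<Rightarrow> (nat \<Rightarrow> complex) \<Rightarrow> nat \<Rightarrow> complex" where
  "residual n y e t = y t - (\<Sum>c<n. y c * e c)"

text \<open>\<open>Z a t\<close>, \<open>W a t\<close> and \<open>Y a t\<close> are the noiseless observation, the noise and the observation of
  antenna \<open>a\<close> in slot \<open>t\<close>. The slots below \<open>n\<close> act as pilots for the effective channel which the
  fixed data slot \<open>t\<close> sees: without noise, \<open>Y a t\<close> is the combination of the pilot observations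
  with the data symbols as coefficients.\<close>

locale data_slot =
  fixes g D Z Y W :: "nat \<Rightarrow> nat \<Rightarrow> complex" and \<gamma> \<tau> :: real and T r n t :: nat
  assumes Z: "\<And>a t'. t' < T \<Longrightarrow> Z a t' = complex_of_real \<gamma> * (\<Sum>c<r. g a c * precoder D c t')"
    and n: "n \<le> r" "r \<le> t" "t < T" and D: "\<And>c. n \<le> c \<Longrightarrow> D c t = 0"
    and Y: "\<And>a t'. a < n \<Longrightarrow> t' < T \<Longrightarrow> Y a t' = Z a t' + W a t'"
    and W: "\<And>a t'. a < n \<Longrightarrow> t' < T \<Longrightarrow> cmod (W a t') \<le> \<tau>"
begin

text \<open>All coordinates \<open>c < r\<close> seen here are below \<open>t\<close>, so the pilot
  in coordinate \<open>t\<close> is invisible.\<close>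

lemma pilot_relation: "Z a t = (\<Sum>c'<n. Z a c' * D c' t)"
proof -
  have "precoder D c t = (\<Sum>c'<n. precoder D c c' * D c' t)" if "c < r" for c
    by (rule precoder_off_diagonal) (use that n D in auto)
  hence "Z a t = \<gamma> * (\<Sum>c<r. g a c * (\<Sum>c'<n. precoder D c c' * D c' t))"
    unfolding Z[OF n(3)] by simp
  also have "\<dots> = (\<Sum>c'<n. \<gamma> * (\<Sum>c<r. g a c * precoder D c c') * D c' t)"
    unfolding sum_distrib_left sum_distrib_right by (subst sum.swap) (simp add: mult_ac)
  also have "\<dots> = (\<Sum>c'<n. Z a c' * D c' t)"
    using n by (intro sum.cong refl) (simp add: Z)
  finally show ?thesis .
qed

text \<open>By linearity the noiseless part leaves the effective channel applied to the symbol
  error.\<close>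

lemma residual_noisy:
  assumes a: "a < n"
  shows "residual n (Y a) e t = (\<Sum>c<n. Z a c * (D c t - e c)) + residual n (W a) e t"
proof -
  have "(\<Sum>c<n. Y a c * e c) = (\<Sum>c<n. (Z a c + W a c) * e c)"
    using n by (intro sum.cong refl) (simp add: Y[OF a])
  thus ?thesis
    unfolding residual_def Y[OF a n(3)] pilot_relation[of a]
    by (simp add: sum_subtractf sum.distrib algebra_simps)
qed

lemma cmod_residual_noise_le:
  assumes a: "a < n" and e: "\<And>c. cmod (e c) \<le> 2"
  shows "cmod (residual n (W a) e t) \<le> \<tau> * (1 + 2 * real n)"
proof -
  have "0 \<le> \<tau>" using W[OF a n(3)] norm_ge_zero order_trans by blast
  have "cmod (residual n (W a) e t) \<le> cmod (W a t) + (\<Sum>c<n. cmod (W a c * e c))"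
    unfolding residual_def by (intro order.trans[OF norm_triangle_ineq4] add_left_mono norm_sum)
  also have "\<dots> \<le> \<tau> + (\<Sum>c<n. \<tau> * 2)"
    unfolding norm_mult using n \<open>0 \<le> \<tau>\<close> by (intro add_mono sum_mono mult_mono W[OF a] e) auto
  finally show ?thesis by (simp add: algebra_simps)
qed

lemma residual_true_symbol:
  assumes a: "a < n" and e: "\<And>c. cmod (e c) \<le> 2" "\<And>c. c < n \<Longrightarrow> e c = D c t"
  shows "cmod (residual n (Y a) e t) \<le> \<tau> * (1 + 2 * real n)"
proof -
  have "residual n (Y a) e t = residual n (W a) e t"
    unfolding residual_noisy[OF a] using e(2) by simp
  thus ?thesis using cmod_residual_noise_le[OF a e(1)] by simp
qed

text \<open>If all antennas passed, the effective channel would map the symbol error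
  \<open>v\<close> to a small vector. That channel is the true one after \<open>precoder\<close>, so
  \<open>cond\<close> would make the precoded error \<open>u\<close> small, against
  \<open>precoder_expands\<close>. The factor \<open>2\<close> on \<open>\<kappa>\<close> adds up
  the test threshold and the noise bound.\<close>

lemma residual_wrong_symbol:
  assumes e: "\<And>c. cmod (e c) \<le> 2"
    and cond: "\<And>u x b. (\<And>a. a < n \<Longrightarrow> cmod (\<Sum>c<n. g a c * u c) \<le> x) \<Longrightarrow> b < n \<Longrightarrow> cmod (u b) \<le> \<kappa> * x"
    and ne: "i0 < n" "D i0 t \<noteq> e i0"
    and sep: "\<And>i. i < n \<Longrightarrow> D i t \<noteq> e i \<Longrightarrow> \<Delta> \<le> cmod (D i t - e i)"
    and \<gamma>: "0 < \<gamma>" "2 * \<kappa> * \<tau> * (1 + 2 * real n) < \<gamma> * \<Delta>"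
  shows "\<exists>a<n. \<not> cmod (residual n (Y a) e t) \<le> \<tau> * (1 + 2 * real n)"
proof (rule ccontr)
  assume "\<not> ?thesis"
  hence small: "cmod (residual n (Y a) e t) \<le> \<tau> * (1 + 2 * real n)" if "a < n" for a
    using that by blast
  define v where "v c = D c t - e c" for c
  define u where "u c = (\<Sum>c'<n. precoder D c c' * v c')" for c
  obtain i where i: "i < n" "\<Delta> \<le> cmod (u i)"
    unfolding u_def by (rule precoder_expands[of i0 n v \<Delta> D]) (use ne sep in \<open>auto simp: v_def\<close>)
  have "cmod (u i) \<le> \<kappa> * (2 * \<tau> * (1 + 2 * real n) / \<gamma>)"
  proof (rule cond[OF _ i(1)])
    fix a assume a: "a < n"
    have "(\<Sum>c'<n. Z a c' * v c') = \<gamma> * (\<Sum>c<r. g a c * u c)"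
    proof -
      have "(\<Sum>c'<n. Z a c' * v c') = (\<Sum>c'<n. \<gamma> * (\<Sum>c<r. g a c * precoder D c c') * v c')"
        using n by (intro sum.cong refl) (simp add: Z)
      also have "\<dots> = \<gamma> * (\<Sum>c<r. g a c * u c)"
        unfolding u_def sum_distrib_left sum_distrib_right by (subst sum.swap) (simp add: mult_ac)
      finally show ?thesis .
    qed
    \<comment> \<open>Upper triangularity makes \<open>u c\<close> vanish for
      \<open>n \<le> c\<close>, so only the square block that \<open>cond\<close> controls
      remains.\<close>
    also have "(\<Sum>c<r. g a c * u c) = (\<Sum>c<n. g a c * u c)"
      unfolding u_def using n
      by (intro sum.mono_neutral_right) (auto intro!: sum.neutral simp: precoder_below_diagonal)
    finally have "\<gamma> * (\<Sum>c<n. g a c * u c) = residual n (Y a) e t - residual n (W a) e t"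
      using residual_noisy[OF a, of e] by (simp add: v_def)
    hence "\<gamma> * cmod (\<Sum>c<n. g a c * u c) = cmod (residual n (Y a) e t - residual n (W a) e t)"
      using \<gamma>(1) by (metis norm_mult norm_of_real abs_of_pos)
    also have "\<dots> \<le> \<tau> * (1 + 2 * real n) + \<tau> * (1 + 2 * real n)"
      by (intro order.trans[OF norm_triangle_ineq4] add_mono small[OF a] cmod_residual_noise_le[OF a e])
    finally show "cmod (\<Sum>c<n. g a c * u c) \<le> 2 * \<tau> * (1 + 2 * real n) / \<gamma>"
      using \<gamma>(1) by (simp add: field_simps)
  qed
  hence "\<gamma> * cmod (u i) \<le> 2 * \<kappa> * \<tau> * (1 + 2 * real n)"
    using \<gamma>(1) by (simp add: field_simps)
  moreover have "\<gamma> * \<Delta> \<le> \<gamma> * cmod (u i)" using i \<gamma>(1) by simp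
  ultimately show False using \<gamma>(2) by linarith
qed

end

section \<open>The data constellation and its rate\<close>

text \<open>The value \<open>0\<close> off the grid keeps the modulus bound valid for every index
  pair, also where no codeword prescribes the symbol.\<close>

definition point :: "nat \<Rightarrow> nat \<times> nat \<Rightarrow> complex" where
  "point Q ij = (if fst ij < Q \<and> snd ij < Q then Complex (real (fst ij) / real Q) (real (snd ij) / real Q) else 0)"

lemma cmod_point_le: "cmod (point Q ij) \<le> 2"
proof (cases "fst ij < Q \<and> snd ij < Q")
  case True
  have "cmod (point Q ij) \<le> \<bar>real (fst ij) / real Q\<bar> + \<bar>real (snd ij) / real Q\<bar>"
    using True cmod_le[of "point Q ij"] by (simp add: point_def)
  also have "\<dots> \<le> 1 + 1" using True by (intro add_mono) auto
  finally show ?thesis by simp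
qed (auto simp: point_def)

lemma point_separation:
  assumes "ij \<in> {..<Q} \<times> {..<Q}" "ij' \<in> {..<Q} \<times> {..<Q}" "ij \<noteq> ij'"
  shows "1 / real Q \<le> cmod (point Q ij - point Q ij')"
proof -
  have *: "1 / real Q \<le> \<bar>real i / real Q - real j / real Q\<bar>" if "i \<noteq> j" for i j :: nat
  proof -
    have "1 \<le> \<bar>real i - real j\<bar>" using that by linarith
    thus ?thesis by (simp add: diff_divide_distrib[symmetric] divide_right_mono)
  qed
  have re: "Re (point Q ij - point Q ij') = real (fst ij) / real Q - real (fst ij') / real Q"
    and im: "Im (point Q ij - point Q ij') = real (snd ij) / real Q - real (snd ij') / real Q"
    using assms(1,2) by (auto simp: point_def)
  from assms(3) consider "fst ij \<noteq> fst ij'" | "snd ij \<noteq> snd ij'" by (auto simp: prod_eq_iff)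
  thus ?thesis
  proof cases
    case 1
    from *[OF 1] show ?thesis unfolding re[symmetric] using abs_Re_le_cmod order_trans by blast
  next
    case 2
    from *[OF 2] show ?thesis unfolding im[symmetric] using abs_Im_le_cmod order_trans by blast
  qed
qed

text \<open>The grid has at least \<open>\<beta> * \<beta> * \<rho> / 4\<close> points, so
  \<open>e\<close> symbols carry \<open>e * ln \<rho>\<close> up to a constant. The slack
  \<open>(\<eta> - 4 / h) * e * ln \<rho>\<close> absorbs that constant and \<open>ln 2\<close>; for
  \<open>e = 0\<close> the first alternative holds.\<close>

lemma eventually_rate:
  fixes \<beta> \<eta> :: real
  assumes \<beta>: "0 < \<beta>" and \<eta>: "4 / real h < \<eta>" "\<eta> < 1"
  shows "eventually (\<lambda>\<rho>. 0 < nat \<lfloor>\<beta> * sqrt \<rho>\<rfloor> \<and> ((1 - \<eta>) * real e * ln \<rho> \<le> 0 \<or>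
     (1 - \<eta>) * real e * ln \<rho> \<le> (1 - 4 / real h) * ln (real ((nat \<lfloor>\<beta> * sqrt \<rho>\<rfloor> * nat \<lfloor>\<beta> * sqrt \<rho>\<rfloor>) ^ e)) - ln 2)) at_top"
proof -
  define X where "X = (ln 2 - (1 - 4 / real h) * (2 * real e * ln (\<beta> / 2))) / ((\<eta> - 4 / real h) * real e)"
  have "eventually (\<lambda>\<rho>. X \<le> ln \<rho>) at_top"
    using ln_at_top filterlim_at_top by blast
  moreover have "eventually (\<lambda>\<rho>. 2 / \<beta> \<le> sqrt \<rho>) at_top"
    using sqrt_at_top filterlim_at_top by blast
  ultimately show ?thesis
    using eventually_gt_at_top[of 0]
  proof eventually_elim
    case (elim \<rho>)
    define Q where "Q = nat \<lfloor>\<beta> * sqrt \<rho>\<rfloor>"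
    have b: "2 \<le> \<beta> * sqrt \<rho>" using elim(2) \<beta> by (simp add: field_simps)
    have Q: "\<beta> / 2 * sqrt \<rho> \<le> real Q" using b unfolding Q_def by linarith
    hence "0 < real Q" using b by linarith
    have "(1 - \<eta>) * real e * ln \<rho> \<le> (1 - 4 / real h) * ln (real ((Q * Q) ^ e)) - ln 2" if e: "0 < e"
    proof -
      have pos: "0 < (\<eta> - 4 / real h) * real e" using \<eta> e by simp
      have "ln (\<beta> / 2 * sqrt \<rho>) \<le> ln (real Q)"
        using Q b \<open>0 < real Q\<close> by (subst ln_le_cancel_iff) auto
      moreover have "ln (\<beta> / 2 * sqrt \<rho>) = ln (\<beta> / 2) + ln \<rho> / 2"
        using \<beta> elim(3) by (subst ln_mult) (auto simp: ln_sqrt)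
      ultimately have "real e * (2 * ln (\<beta> / 2) + ln \<rho>) \<le> real e * (2 * ln (real Q))"
        by (intro mult_left_mono) auto
      moreover have "ln (real ((Q * Q) ^ e)) = real e * (2 * ln (real Q))"
        using \<open>0 < real Q\<close> by (simp add: ln_realpow ln_mult)
      ultimately have "(1 - 4 / real h) * (real e * (2 * ln (\<beta> / 2) + ln \<rho>)) \<le> (1 - 4 / real h) * ln (real ((Q * Q) ^ e))"
        using \<eta> by (intro mult_left_mono) auto
      moreover have "ln 2 - (1 - 4 / real h) * (2 * real e * ln (\<beta> / 2)) \<le> ln \<rho> * ((\<eta> - 4 / real h) * real e)"
        using elim(1) pos unfolding X_def by (simp add: pos_divide_le_eq)
      ultimately show ?thesis by (simp add: algebra_simps)
    qed
    thus ?case using \<open>0 < real Q\<close> unfolding Q_def[symmetric] by (cases "e = 0") auto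
  qed
qed

section \<open>The nested broadcast channel\<close>

locale nested_broadcast =
  fixes M K T :: nat and N r :: "nat \<Rightarrow> nat"
    and U :: "nat \<Rightarrow> nat \<Rightarrow> nat \<Rightarrow> complex" and s :: "nat \<Rightarrow> nat \<Rightarrow> real"
    and Gd :: "nat \<Rightarrow> (nat \<times> nat \<Rightarrow> complex) measure"
  assumes K: "1 \<le> K"
    and dims: "\<And>k. k \<in> {1..K} \<Longrightarrow> 1 \<le> N k" "\<And>k. k \<in> {1..K} \<Longrightarrow> 1 \<le> r k"
    and orth: "\<And>b b'. b < r 1 \<Longrightarrow> b' < r 1 \<Longrightarrow>
                 (\<Sum>i<M. cnj (U 1 i b) * U 1 i b') = (if b = b' then 1 else 0)"
    and spos: "\<And>k b. k \<in> {1..K} \<Longrightarrow> b < r k \<Longrightarrow> 0 < s k b"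
    and Gprob: "\<And>k. k \<in> {1..K} \<Longrightarrow> prob_space (Gd k)"
    and Gent: "\<And>k. k \<in> {1..K} \<Longrightarrow> diff_entropy_gt_minf (Gd k) (N k) (r k)"
    and T: "2 * r 1 \<le> T"
    and r_mono: "\<And>k. k \<in> {2..K} \<Longrightarrow> r k \<le> r (k - 1)"
    and nested: "\<And>k i b. k \<in> {2..K} \<Longrightarrow> i < M \<Longrightarrow> b < r k \<Longrightarrow> U (k - 1) i (r (k - 1) - r k + b) = U k i b"
begin

section \<open>Assignment of slots to users\<close>

definition nstar :: "nat \<Rightarrow> nat" where "nstar k = min (N k) (r k)"

text \<open>Realises the convention \<open>r 0 = T\<close>, since the given \<open>r\<close> is
  arbitrary at \<open>0\<close>.\<close>

definition slot_end :: "nat \<Rightarrow> nat" where "slot_end k = (if k = 1 then T else r (k - 1))"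

text \<open>For \<open>t < r K\<close> no user qualifies, and the alternative \<open>K < k\<close>
  yields the dummy user \<open>K + 1\<close>. The entries of \<open>data\<close> are bounded there
  too, and \<open>precoder\<close> is unit triangular for any coefficients.\<close>

definition slot_user :: "nat \<Rightarrow> nat" where
  "slot_user t = (LEAST k. 1 \<le> k \<and> (K < k \<or> r k \<le> t))"

definition num_streams :: "nat \<Rightarrow> nat" where "num_streams k = nstar k * (slot_end k - r k)"

lemma T_pos: "0 < T"
  using T dims(2)[of 1] K by simp

lemma r_antimono: "1 \<le> j \<Longrightarrow> j \<le> k \<Longrightarrow> k \<le> K \<Longrightarrow> r k \<le> r j"
proof (induction k)
  case (Suc k)
  show ?case
  proof (cases "j = Suc k")
    case False
    hence "r k \<le> r j" using Suc by simp
    moreover have "r (Suc k) \<le> r k" using r_mono[of "Suc k"] Suc.prems False by simp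
    ultimately show ?thesis by simp
  qed simp
qed simp

lemma r_le_slot_end: "k \<in> {1..K} \<Longrightarrow> r k \<le> slot_end k"
  using r_mono[of k] T by (auto simp: slot_end_def)

lemma slot_end_le:
  assumes "k \<in> {1..K}"
  shows "slot_end k \<le> T"
proof (cases "k = 1")
  case False
  hence "r (k - 1) \<le> r 1" using assms by (intro r_antimono) auto
  thus ?thesis using T False by (simp add: slot_end_def)
qed (simp add: slot_end_def)

lemma nstar_le: "nstar k \<le> N k" "nstar k \<le> r k"
  by (auto simp: nstar_def)

text \<open>The slot ranges are disjoint because \<open>r\<close> is antitone: a user
  \<open>j < k\<close> has \<open>r j \<ge> r (k - 1)\<close>, which exceeds
  \<open>t\<close>.\<close>

lemma slot_user_eq:
  assumes k: "k \<in> {1..K}" and t: "t \<in> {r k..<slot_end k}"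
  shows "slot_user t = k"
  unfolding slot_user_def
proof (rule Least_equality)
  show "1 \<le> k \<and> (K < k \<or> r k \<le> t)" using k t by simp
  fix j assume j: "1 \<le> j \<and> (K < j \<or> r j \<le> t)"
  show "k \<le> j"
  proof (rule ccontr)
    assume "\<not> k \<le> j"
    hence "r (k - 1) \<le> r j" "r j \<le> t" "k \<noteq> 1" using j k r_antimono[of j "k - 1"] by auto
    thus False using t by (simp add: slot_end_def)
  qed
qed

text \<open>Iterated nesting, so that one basis serves all users.\<close>

lemma nested_first: "1 \<le> k \<Longrightarrow> k \<le> K \<Longrightarrow> i < M \<Longrightarrow> b < r k \<Longrightarrow> U 1 i (r 1 - r k + b) = U k i b"
proof (induction k arbitrary: b)
  case (Suc k)
  show ?case
  proof (cases "k = 0")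
    case False
    note step = Suc False
    have le: "r (Suc k) \<le> r k" "r k \<le> r 1"
      using r_mono[of "Suc k"] r_antimono[of 1 k] step by auto
    have "U (Suc k) i b = U k i (r k - r (Suc k) + b)"
      using nested[of "Suc k" i b] step by simp
    also have "\<dots> = U 1 i (r 1 - r k + (r k - r (Suc k) + b))"
      using step le by (intro step(1)[symmetric]) auto
    also have "r 1 - r k + (r k - r (Suc k) + b) = r 1 - r (Suc k) + b" using le by simp
    finally show ?thesis ..
  qed simp
qed simp

text \<open>Coordinates are counted from the end of the common eigenbasis, so that user \<open>k\<close> sees
  exactly the coordinates below \<open>r k\<close>.\<close>

definition beam :: "(nat \<Rightarrow> complex) \<Rightarrow> nat \<Rightarrow> complex" where
  "beam z i = (\<Sum>c<r 1. U 1 i (r 1 - 1 - c) * z c)"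

text \<open>The matrix \<open>G Sigma^(1/2)\<close> with its columns reversed, to match coordinates
  counted from the end.\<close>

definition gain :: "nat \<Rightarrow> (nat \<times> nat \<Rightarrow> complex) \<Rightarrow> nat \<Rightarrow> nat \<Rightarrow> complex" where
  "gain k G a c = G (a, r k - 1 - c) * complex_of_real (sqrt (s k (r k - 1 - c)))"

text \<open>\<open>\<kappa>\<close> bounds the inverse of the leading square block of
  \<open>gain\<close> in the maximum norm, phrased without an inverse matrix.\<close>

definition well_conditioned :: "nat \<Rightarrow> real \<Rightarrow> (nat \<times> nat \<Rightarrow> complex) \<Rightarrow> bool" where
  "well_conditioned k \<kappa> G \<longleftrightarrow> (\<forall>u x. (\<forall>a<nstar k. cmod (\<Sum>c<nstar k. gain k G a c * u c) \<le> x) \<longrightarrow>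
     (\<forall>b<nstar k. cmod (u b) \<le> \<kappa> * x))"

text \<open>Column \<open>b\<close> of \<open>U k\<close> is column \<open>r 1 - r k + b\<close> of
  \<open>U 1\<close>, which carries coordinate \<open>r k - 1 - b\<close>. Coordinates from
  \<open>r k\<close> on are thus orthogonal to all eigenvectors of user \<open>k\<close>.\<close>

lemma cnj_eigenvector_beam:
  assumes k: "k \<in> {1..K}" and b: "b < r k"
  shows "(\<Sum>i<M. cnj (U k i b) * beam z i) = z (r k - 1 - b)"
proof -
  have le: "r k \<le> r 1" using k r_antimono[of 1 k] by simp
  have "(\<Sum>i<M. cnj (U k i b) * beam z i) =
      (\<Sum>i<M. \<Sum>c<r 1. cnj (U 1 i (r 1 - r k + b)) * U 1 i (r 1 - 1 - c) * z c)"
    unfolding beam_def sum_distrib_left using k b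
    by (intro sum.cong refl) (simp add: nested_first[of k, symmetric] mult.assoc)
  also have "\<dots> = (\<Sum>c<r 1. (\<Sum>i<M. cnj (U 1 i (r 1 - r k + b)) * U 1 i (r 1 - 1 - c)) * z c)"
    by (subst sum.swap) (simp add: sum_distrib_right)
  also have "\<dots> = (\<Sum>c<r 1. if r k - 1 - b = c then z c else 0)"
  proof (rule sum.cong[OF refl])
    fix c assume c: "c \<in> {..<r 1}"
    have "(r 1 - r k + b = r 1 - 1 - c) \<longleftrightarrow> (r k - 1 - b = c)" using le b c by auto
    thus "(\<Sum>i<M. cnj (U 1 i (r 1 - r k + b)) * U 1 i (r 1 - 1 - c)) * z c = (if r k - 1 - b = c then z c else 0)"
      using orth[of "r 1 - r k + b" "r 1 - 1 - c"] le b c by simp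
  qed
  also have "\<dots> = z (r k - 1 - b)" using le b by simp
  finally show ?thesis .
qed

lemma chanH_beam:
  assumes k: "k \<in> {1..K}"
  shows "(\<Sum>i<M. chanH (U k) (s k) (r k) G a i * (\<gamma> * beam z i)) = \<gamma> * (\<Sum>c<r k. gain k G a c * z c)"
proof -
  have "(\<Sum>i<M. chanH (U k) (s k) (r k) G a i * (\<gamma> * beam z i)) =
      \<gamma> * (\<Sum>b<r k. G (a, b) * complex_of_real (sqrt (s k b)) * (\<Sum>i<M. cnj (U k i b) * beam z i))"
    unfolding chanH_def sum_distrib_left sum_distrib_right by (subst sum.swap) (simp add: mult_ac)
  also have "\<dots> = \<gamma> * (\<Sum>b<r k. G (a, b) * complex_of_real (sqrt (s k b)) * z (r k - 1 - b))"
    using cnj_eigenvector_beam[OF k] by simp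
  also have "(\<Sum>b<r k. G (a, b) * complex_of_real (sqrt (s k b)) * z (r k - 1 - b)) = (\<Sum>c<r k. gain k G a c * z c)"
    by (subst sum.nat_diff_reindex[symmetric]) (auto intro!: sum.cong simp: gain_def)
  finally show ?thesis .
qed

lemma received_beam:
  assumes k: "k \<in> {1..K}" and "l < L" "t < T" "a < N k"
  shows "received M T (N k) (U k) (s k) (r k) L (\<lambda>j i. \<gamma> * beam (z (j div T) (j mod T)) i) \<omega> (l * T + t, a) =
           \<gamma> * (\<Sum>c<r k. gain k (fst \<omega> l) a c * z l t c) + snd \<omega> (l * T + t, a)"
proof -
  have "l * T + t < (l + 1) * T" using assms by simp
  also have "\<dots> \<le> L * T" using assms by (intro mult_right_mono) auto
  finally show ?thesis using assms by (simp add: received_def chanH_beam)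
qed

text \<open>One constant serves all messages and SNRs, so scaling by
  \<open>sqrt (\<rho> / C)\<close> meets the power constraint. The summand \<open>1\<close> in the
  witness makes it positive.\<close>

lemma beam_power_bound:
  "\<exists>C>0. \<forall>D t. (\<forall>c t. cmod (D c t) \<le> 2) \<longrightarrow> t < T \<longrightarrow>
     (\<Sum>i<M. (cmod (beam (\<lambda>c. precoder D c t) i))\<^sup>2) \<le> C"
proof -
  define b where "b i = (\<Sum>c<r 1. cmod (U 1 i (r 1 - 1 - c)) * (1 + 2 * real T) ^ T)" for i
  show ?thesis
  proof (intro exI[of _ "1 + (\<Sum>i<M. (b i)\<^sup>2)"] conjI allI impI)
    show "0 < 1 + (\<Sum>i<M. (b i)\<^sup>2)" by (intro add_pos_nonneg sum_nonneg) auto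
    fix D :: "nat \<Rightarrow> nat \<Rightarrow> complex" and t assume D: "\<forall>c t. cmod (D c t) \<le> 2" and t: "t < T"
    have "cmod (beam (\<lambda>c. precoder D c t) i) \<le> b i" for i
      unfolding beam_def b_def
    proof (rule sum_norm_le)
      fix c
      have "cmod (precoder D c t) \<le> (1 + 2 * real T) ^ t"
        using cmod_precoder_le[OF D[rule_format], of t T] t by simp
      also have "\<dots> \<le> (1 + 2 * real T) ^ T" using t by (intro power_increasing) auto
      finally show "cmod (U 1 i (r 1 - 1 - c) * precoder D c t) \<le> cmod (U 1 i (r 1 - 1 - c)) * (1 + 2 * real T) ^ T"
        unfolding norm_mult by (intro mult_left_mono) auto
    qed
    hence "(\<Sum>i<M. (cmod (beam (\<lambda>c. precoder D c t) i))\<^sup>2) \<le> (\<Sum>i<M. (b i)\<^sup>2)"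
      by (intro sum_mono power_mono) auto
    thus "(\<Sum>i<M. (cmod (beam (\<lambda>c. precoder D c t) i))\<^sup>2) \<le> 1 + (\<Sum>i<M. (b i)\<^sup>2)" by simp
  qed
qed

lemma gain_well_conditioned:
  assumes k: "k \<in> {1..K}" and p: "0 < p"
  obtains \<kappa> B where "0 < \<kappa>" "B \<in> sets (Gd k)" "measure (Gd k) B < p"
    "\<And>G. G \<in> space (Gd k) - B \<Longrightarrow> well_conditioned k \<kappa> G"
proof -
  let ?h = "\<lambda>c. r k - 1 - c"
  let ?\<sigma> = "\<lambda>c. complex_of_real (sqrt (s k (r k - 1 - c)))"
  have inj: "inj_on ?h {..<nstar k}" using nstar_le[of k] by (auto simp: inj_on_def)
  have less: "?h c < r k" for c using dims(2)[OF k] by simp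
  hence nz: "?\<sigma> c \<noteq> 0" for c using spos[OF k, of "?h c"] by simp
  show thesis
  proof (rule well_conditioned_event[OF Gprob[OF k] Gent[OF k] nstar_le(1) inj less nz p])
    fix \<kappa> B
    assume "0 < \<kappa>" "B \<in> sets (Gd k)" "measure (Gd k) B < p"
      and *: "\<And>G u x b. G \<in> space (Gd k) - B \<Longrightarrow>
        (\<And>a. a < nstar k \<Longrightarrow> cmod (\<Sum>c<nstar k. G (a, ?h c) * ?\<sigma> c * u c) \<le> x)
        \<Longrightarrow> b < nstar k \<Longrightarrow> cmod (u b) \<le> \<kappa> * x"
    show thesis
    proof (rule that)
      show "well_conditioned k \<kappa> G" if "G \<in> space (Gd k) - B" for G
        using *[OF that] unfolding well_conditioned_def gain_def by simp
    qed fact+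
  qed
qed

section \<open>Block letters and their test\<close>

text \<open>All data of user \<open>k\<close> in one block form a single letter of its code over the
  blocks.\<close>

definition symbols :: "(nat \<Rightarrow> nat) \<Rightarrow> nat \<Rightarrow> (nat \<times> nat \<Rightarrow> nat \<times> nat) set" where
  "symbols Q k = PiE ({..<nstar k} \<times> {r k..<slot_end k}) (\<lambda>_. {..<Q k} \<times> {..<Q k})"

text \<open>The coefficient matrix for \<open>precoder\<close>, assembled from the letters of all
  users. Rows from \<open>nstar k\<close> on are zero in the slots of user \<open>k\<close>, so only
  the first \<open>nstar k\<close> slots act as its pilots.\<close>

definition data :: "(nat \<Rightarrow> nat) \<Rightarrow> (nat \<Rightarrow> nat \<times> nat \<Rightarrow> nat \<times> nat) \<Rightarrow> nat \<Rightarrow> nat \<Rightarrow> complex" where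
  "data Q a c t = (let k = slot_user t in if c < nstar k then point (Q k) (a k (c, t)) else 0)"

text \<open>The threshold bounds the residual which noise of modulus at most \<open>\<tau>\<close>
  leaves for the true letter. The test uses neither the fading nor the data of other users.\<close>

definition consistent :: "(nat \<Rightarrow> nat) \<Rightarrow> real \<Rightarrow> nat \<Rightarrow> (nat \<Rightarrow> nat \<Rightarrow> complex) \<Rightarrow> (nat \<times> nat \<Rightarrow> nat \<times> nat) \<Rightarrow> bool" where
  "consistent Q \<tau> k Y a \<longleftrightarrow> (\<forall>t\<in>{r k..<slot_end k}. \<forall>b<nstar k.
     cmod (residual (nstar k) (Y b) (\<lambda>c. point (Q k) (a (c, t))) t) \<le> \<tau> * (1 + 2 * real (nstar k)))"

lemma finite_symbols: "finite (symbols Q k)"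
  by (simp add: symbols_def finite_PiE)

lemma card_symbols: "card (symbols Q k) = (Q k * Q k) ^ num_streams k"
  by (simp add: symbols_def card_PiE num_streams_def card_cartesian_product)

lemma cmod_data_le: "cmod (data Q a c t) \<le> 2"
  by (simp add: data_def Let_def cmod_point_le)

lemma data_slotI:
  assumes k: "k \<in> {1..K}" and t: "t \<in> {r k..<slot_end k}"
    and Y: "\<And>b t'. b < nstar k \<Longrightarrow> t' < T \<Longrightarrow>
      Y b t' = complex_of_real \<gamma> * (\<Sum>c<r k. gain k G b c * precoder (data Q a) c t') + W b t'"
    and W: "\<And>b t'. b < nstar k \<Longrightarrow> t' < T \<Longrightarrow> cmod (W b t') \<le> \<tau>"
  shows "data_slot (gain k G) (data Q a) (\<lambda>b t'. complex_of_real \<gamma> * (\<Sum>c<r k. gain k G b c * precoder (data Q a) c t'))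
     Y W \<gamma> \<tau> T (r k) (nstar k) t"
proof
  show "data Q a c t = 0" if "nstar k \<le> c" for c
    using that slot_user_eq[OF k t] by (simp add: data_def)
qed (use nstar_le slot_end_le[OF k] t Y W in auto)

lemma consistent_true:
  assumes k: "k \<in> {1..K}"
    and Y: "\<And>b t'. b < nstar k \<Longrightarrow> t' < T \<Longrightarrow>
      Y b t' = complex_of_real \<gamma> * (\<Sum>c<r k. gain k G b c * precoder (data Q a) c t') + W b t'"
    and W: "\<And>b t'. b < nstar k \<Longrightarrow> t' < T \<Longrightarrow> cmod (W b t') \<le> \<tau>"
  shows "consistent Q \<tau> k Y (a k)"
  unfolding consistent_def
proof (intro ballI allI impI)
  fix t b assume t: "t \<in> {r k..<slot_end k}" and b: "b < nstar k"
  interpret data_slot "gain k G" "data Q a"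
    "\<lambda>b t'. complex_of_real \<gamma> * (\<Sum>c<r k. gain k G b c * precoder (data Q a) c t')"
    Y W \<gamma> \<tau> T "r k" "nstar k" t
    by (rule data_slotI[OF k t]) (fact Y W)+
  show "cmod (residual (nstar k) (Y b) (\<lambda>c. point (Q k) (a k (c, t))) t) \<le> \<tau> * (1 + 2 * real (nstar k))"
    by (rule residual_true_symbol[OF b]) (use slot_user_eq[OF k t] in \<open>simp_all add: cmod_point_le data_def\<close>)
qed

text \<open>Distinct letters differ in a symbol of some slot, by at least the grid spacing, and the
  test of that slot exposes the wrong one.\<close>

lemma consistent_wrong:
  assumes k: "k \<in> {1..K}"
    and Y: "\<And>b t'. b < nstar k \<Longrightarrow> t' < T \<Longrightarrow>
      Y b t' = complex_of_real \<gamma> * (\<Sum>c<r k. gain k G b c * precoder (data Q a) c t') + W b t'"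
    and W: "\<And>b t'. b < nstar k \<Longrightarrow> t' < T \<Longrightarrow> cmod (W b t') \<le> \<tau>"
    and cond: "well_conditioned k \<kappa> G"
    and \<gamma>: "0 < \<gamma>" "2 * \<kappa> * \<tau> * (1 + 2 * real (nstar k)) < \<gamma> * (1 / real (Q k))"
    and sym: "a k \<in> symbols Q k" "a' \<in> symbols Q k" "a' \<noteq> a k"
  shows "\<not> consistent Q \<tau> k Y a'"
proof -
  obtain c0 t where ct: "c0 < nstar k" "t \<in> {r k..<slot_end k}" "a' (c0, t) \<noteq> a k (c0, t)"
  proof -
    have "\<exists>x\<in>{..<nstar k} \<times> {r k..<slot_end k}. a' x \<noteq> a k x"
      using PiE_ext[OF sym(2,1)[unfolded symbols_def]] sym(3) by blast
    thus thesis using that by auto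
  qed
  interpret data_slot "gain k G" "data Q a"
    "\<lambda>b t'. complex_of_real \<gamma> * (\<Sum>c<r k. gain k G b c * precoder (data Q a) c t')"
    Y W \<gamma> \<tau> T "r k" "nstar k" t
    by (rule data_slotI[OF k ct(2)]) (fact Y W)+
  have d: "data Q a c t = point (Q k) (a k (c, t))" if "c < nstar k" for c
    using that slot_user_eq[OF k ct(2)] by (simp add: data_def)
  have range: "a k (c, t) \<in> {..<Q k} \<times> {..<Q k}" "a' (c, t) \<in> {..<Q k} \<times> {..<Q k}" if "c < nstar k" for c
    using sym(1,2)[unfolded symbols_def, THEN PiE_mem, of "(c, t)"] ct(2) that by auto
  have sep: "1 / real (Q k) \<le> cmod (data Q a c t - point (Q k) (a' (c, t)))"
    if "c < nstar k" "a' (c, t) \<noteq> a k (c, t)" for c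
    unfolding d[OF that(1)] using point_separation[OF range[OF that(1)]] that(2) by auto
  have "\<exists>b<nstar k. \<not> cmod (residual (nstar k) (Y b) (\<lambda>c. point (Q k) (a' (c, t))) t) \<le> \<tau> * (1 + 2 * real (nstar k))"
  proof (rule residual_wrong_symbol[where \<Delta> = "1 / real (Q k)" and \<kappa> = \<kappa> and ?i0.0 = c0])
    have "0 < Q k" using range(1)[OF ct(1)] by auto
    thus "data Q a c0 t \<noteq> point (Q k) (a' (c0, t))" using sep[OF ct(1,3)] by auto
    show "1 / real (Q k) \<le> cmod (data Q a i t - point (Q k) (a' (i, t)))"
      if "i < nstar k" "data Q a i t \<noteq> point (Q k) (a' (i, t))" for i
      using that sep[of i] d[of i] by metis
    show "cmod (u b) \<le> \<kappa> * x"
      if "\<And>b. b < nstar k \<Longrightarrow> cmod (\<Sum>c<nstar k. gain k G b c * u c) \<le> x" "b < nstar k" for u x b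
      using cond that unfolding well_conditioned_def by simp
  qed (use \<gamma> ct cmod_point_le in auto)
  thus ?thesis using ct(2) unfolding consistent_def by blast
qed

lemma measurable_consistent:
  assumes k: "k \<in> {1..K}" and l: "l < L"
  shows "Measurable.pred (out_space (N k) (L * T)) (\<lambda>y. consistent Q \<tau> k (\<lambda>b t. y (l * T + t, b)) a)"
proof -
  have [measurable]: "(\<lambda>y. y (l * T + t, b)) \<in> borel_measurable (out_space (N k) (L * T))"
    if "t < T" "b < nstar k" for t b
  proof -
    have "l * T + t < (l + 1) * T" using that by simp
    also have "\<dots> \<le> L * T" using l by (intro mult_right_mono) auto
    finally have "(l * T + t, b) \<in> {..<L * T} \<times> {..<N k}" using that nstar_le(1)[of k] by simp
    thus ?thesis unfolding out_space_def by (rule measurable_component_singleton)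
  qed
  have "(\<lambda>y. residual (nstar k) (\<lambda>t. y (l * T + t, b)) (\<lambda>c. point (Q k) (a (c, t))) t) \<in> borel_measurable (out_space (N k) (L * T))"
    if "t \<in> {r k..<slot_end k}" "b < nstar k" for t b
  proof -
    have "t < T" "\<And>c. c < nstar k \<Longrightarrow> c < T"
      using that slot_end_le[OF k] nstar_le(2)[of k] by auto
    thus ?thesis unfolding residual_def using that by (intro borel_measurable_diff borel_measurable_sum borel_measurable_times borel_measurable_const) auto
  qed
  hence "Measurable.pred (out_space (N k) (L * T))
      (\<lambda>y. cmod (residual (nstar k) (\<lambda>t. y (l * T + t, b)) (\<lambda>c. point (Q k) (a (c, t))) t) \<le> \<tau> * (1 + 2 * real (nstar k)))"
    if "t \<in> {r k..<slot_end k}" "b < nstar k" for t b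
    using that by measurable
  thus ?thesis unfolding consistent_def
    by (intro pred_intros_finite pred_intros_imp') auto
qed

section \<open>Encoder and decoder\<close>

definition encoder :: "real \<Rightarrow> (nat \<Rightarrow> nat) \<Rightarrow> (nat \<Rightarrow> nat \<Rightarrow> nat \<Rightarrow> nat \<times> nat \<Rightarrow> nat \<times> nat) \<Rightarrow> (nat \<Rightarrow> nat) \<Rightarrow> nat \<Rightarrow> nat \<Rightarrow> complex" where
  "encoder \<gamma> Q cw w j i =
     complex_of_real \<gamma> * beam (\<lambda>c. precoder (data Q (\<lambda>k. cw k (w k) (j div T))) c (j mod T)) i"

text \<open>Bounded distance decoding, with distance counted by failed block tests. If no codeword
  qualifies, \<open>LEAST\<close> returns an unspecified index; \<open>decoder_correct\<close>
  excludes this when few blocks are bad.\<close>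

definition decoder :: "(nat \<Rightarrow> nat) \<Rightarrow> real \<Rightarrow> nat \<Rightarrow> nat \<Rightarrow> nat \<Rightarrow> (nat \<Rightarrow> nat \<Rightarrow> nat \<times> nat \<Rightarrow> nat \<times> nat) \<Rightarrow> nat \<Rightarrow> (nat \<times> nat \<Rightarrow> complex) \<Rightarrow> nat" where
  "decoder Q \<tau> L e m cw k y =
     (LEAST v. v < m \<and> card {l. l < L \<and> \<not> consistent Q \<tau> k (\<lambda>b t. y (l * T + t, b)) (cw v l)} \<le> e)"

lemma encoder_power:
  assumes C: "0 < C" "\<And>D t. (\<And>c t. cmod (D c t) \<le> 2) \<Longrightarrow> t < T \<Longrightarrow>
     (\<Sum>i<M. (cmod (beam (\<lambda>c. precoder D c t) i))\<^sup>2) \<le> C" and \<rho>: "0 < \<rho>"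
  shows "1 / real (L * T) * (\<Sum>j<L * T. \<Sum>i<M. (cmod (encoder (sqrt (\<rho> / C)) Q cw w j i))\<^sup>2) \<le> \<rho>"
proof -
  have "(\<Sum>i<M. (cmod (encoder (sqrt (\<rho> / C)) Q cw w j i))\<^sup>2) \<le> \<rho>" for j
  proof -
    let ?b = "\<lambda>i. beam (\<lambda>c. precoder (data Q (\<lambda>k. cw k (w k) (j div T))) c (j mod T)) i"
    have "(cmod (encoder (sqrt (\<rho> / C)) Q cw w j i))\<^sup>2 = \<rho> / C * (cmod (?b i))\<^sup>2" for i
      using \<rho> C(1) by (simp only: encoder_def norm_mult power_mult_distrib norm_of_real power2_abs real_sqrt_pow2_iff) simp
    hence "(\<Sum>i<M. (cmod (encoder (sqrt (\<rho> / C)) Q cw w j i))\<^sup>2) = \<rho> / C * (\<Sum>i<M. (cmod (?b i))\<^sup>2)"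
      by (simp only: sum_distrib_left)
    also have "\<dots> \<le> \<rho> / C * C"
    proof (rule mult_left_mono)
      show "(\<Sum>i<M. (cmod (?b i))\<^sup>2) \<le> C"
        by (rule C(2)) (simp_all only: cmod_data_le mod_less_divisor T_pos)
    qed (use \<rho> C(1) in simp)
    finally show ?thesis using C(1) by simp
  qed
  hence "(\<Sum>j<L * T. \<Sum>i<M. (cmod (encoder (sqrt (\<rho> / C)) Q cw w j i))\<^sup>2) \<le> real (card {..<L * T}) * \<rho>"
    by (intro sum_bounded_above)
  hence *: "(\<Sum>j<L * T. \<Sum>i<M. (cmod (encoder (sqrt (\<rho> / C)) Q cw w j i))\<^sup>2) \<le> real (L * T) * \<rho>"
    by (simp only: card_lessThan)
  have "1 / real (L * T) * (\<Sum>j<L * T. \<Sum>i<M. (cmod (encoder (sqrt (\<rho> / C)) Q cw w j i))\<^sup>2)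
      \<le> 1 / real (L * T) * (real (L * T) * \<rho>)"
    by (rule mult_left_mono[OF *]) simp
  \<comment> \<open>For \<open>L = 0\<close> division by zero makes the left side
    \<open>0\<close>.\<close>
  also have "\<dots> \<le> \<rho>" using \<rho> by (cases "L * T = 0") (simp_all only: mult.assoc[symmetric], simp_all)
  finally show ?thesis .
qed

lemma measurable_decoder:
  assumes k: "k \<in> {1..K}"
  shows "decoder Q \<tau> L e m cw k \<in> measurable (out_space (N k) (L * T)) (count_space UNIV)"
proof -
  have p: "Measurable.pred (out_space (N k) (L * T)) (\<lambda>y. l \<in> {l. l < L \<and> \<not> consistent Q \<tau> k (\<lambda>b t. y (l * T + t, b)) (cw v l)})" for l v
  proof (cases "l < L")
    case True
    from pred_intros_logic(2)[OF measurable_consistent[OF k True]] True show ?thesis by simp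
  qed simp
  have "(\<lambda>y. card {l. l < L \<and> \<not> consistent Q \<tau> k (\<lambda>b t. y (l * T + t, b)) (cw v l)})
     \<in> measurable (out_space (N k) (L * T)) (count_space UNIV)" for v
    by (rule measurable_card[OF p[unfolded pred_def]])
  hence "Measurable.pred (out_space (N k) (L * T)) (\<lambda>y. v < m \<and> card {l. l < L \<and> \<not> consistent Q \<tau> k (\<lambda>b t. y (l * T + t, b)) (cw v l)} \<le> e)" for v
    by (rule measurable_compose[where g = "\<lambda>c. v < m \<and> c \<le> e"]) simp
  thus ?thesis unfolding decoder_def[abs_def] by (rule measurable_Least)
qed

text \<open>Deterministic part: in a block with small noise and a well-conditioned channel, exactly
  the transmitted letter passes, so \<open>minimum_distance_decoding\<close> applies.\<close>

lemma decoder_correct: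
  assumes k: "k \<in> {1..K}" and \<omega>: "\<And>l. l < L \<Longrightarrow> fst \<omega> l \<in> space (Gd k)"
    and w: "w k < m" and cw: "\<And>v. v < m \<Longrightarrow> cw k v \<in> PiE {..<L} (\<lambda>_. symbols Q k)"
    and dist: "\<And>v v'. v < m \<Longrightarrow> v' < m \<Longrightarrow> v \<noteq> v' \<Longrightarrow> 2 * e < hdist L (cw k v) (cw k v')"
    and bad: "card {l. l < L \<and> (fst \<omega> l \<in> B \<or> (\<exists>t<T. \<exists>a<N k. snd \<omega> (l * T + t, a) \<in> {z \<in> space CN01. \<tau> < cmod z}))} \<le> e"
    and cond: "\<And>G. G \<in> space (Gd k) - B \<Longrightarrow> well_conditioned k \<kappa> G"
    and \<gamma>: "0 < \<gamma>" "2 * \<kappa> * \<tau> * (1 + 2 * real (nstar k)) < \<gamma> * (1 / real (Q k))"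
  shows "decoder Q \<tau> L e m (cw k) k (received M T (N k) (U k) (s k) (r k) L (encoder \<gamma> Q cw w) \<omega>) = w k"
proof -
  define y where "y = received M T (N k) (U k) (s k) (r k) L (encoder \<gamma> Q cw w) \<omega>"
  define bad where "bad l \<longleftrightarrow> fst \<omega> l \<in> B \<or> (\<exists>t<T. \<exists>a<N k. snd \<omega> (l * T + t, a) \<in> {z \<in> space CN01. \<tau> < cmod z})" for l
  have y: "y (l * T + t, b) = complex_of_real \<gamma> * (\<Sum>c<r k. gain k (fst \<omega> l) b c * precoder (data Q (\<lambda>k. cw k (w k) l)) c t)
      + snd \<omega> (l * T + t, b)" if "l < L" "b < nstar k" "t < T" for l t b
    unfolding y_def encoder_def[abs_def]
    by (rule received_beam[OF k that(1,3), where z = "\<lambda>l t c. precoder (data Q (\<lambda>k. cw k (w k) l)) c t"])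
      (use that(2) nstar_le(1)[of k] in simp)
  have W: "cmod (snd \<omega> (l * T + t, b)) \<le> \<tau>" if "\<not> bad l" "b < nstar k" "t < T" for l t b
  proof (rule ccontr)
    assume "\<not> ?thesis"
    hence "snd \<omega> (l * T + t, b) \<in> {z \<in> space CN01. \<tau> < cmod z}" by (simp add: CN01_def)
    moreover have "b < N k" using that(2) nstar_le(1)[of k] by simp
    ultimately show False using that(1,3) unfolding bad_def by blast
  qed
  have G: "fst \<omega> l \<in> space (Gd k) - B" if "l < L" "\<not> bad l" for l
    using that(2) \<omega>[OF that(1)] by (simp add: bad_def)
  have "decoder Q \<tau> L e m (cw k) k y = w k"
    unfolding decoder_def
  proof (rule minimum_distance_decoding[where bad = bad and cw = "cw k"
        and ok = "\<lambda>l. consistent Q \<tau> k (\<lambda>b t. y (l * T + t, b))"])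
    show "2 * e < hdist L (cw k (w k)) (cw k v)" if "v < m" "v \<noteq> w k" for v
      by (rule dist[OF w that(1)]) (use that(2) in simp)
    show "card {l. l < L \<and> bad l} \<le> e" unfolding bad_def by (rule bad)
    show "consistent Q \<tau> k (\<lambda>b t. y (l * T + t, b)) (cw k (w k) l)" if "l < L" "\<not> bad l" for l
      by (rule consistent_true[OF k y[OF that(1)] W[OF that(2)]])
    show "\<not> consistent Q \<tau> k (\<lambda>b t. y (l * T + t, b)) (cw k v l)"
      if l: "l < L" "\<not> bad l" and v: "v < m" "cw k v l \<noteq> cw k (w k) l" for l v
    proof (rule consistent_wrong[OF k y[OF l(1)] W[OF l(2)] cond[OF G[OF l]] \<gamma>])
      show "cw k (w k) l \<in> symbols Q k" by (rule PiE_mem[OF cw[OF w]]) (simp add: l(1))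
      show "cw k v l \<in> symbols Q k" by (rule PiE_mem[OF cw[OF v(1)]]) (simp add: l(1))
    qed (use v(2) in simp_all)
  qed (rule w)
  thus ?thesis by (simp only: y_def)
qed

text \<open>The error event lies in the exceptional set of \<open>bad_block_event\<close>, whose
  limit on bad blocks is the decoding radius \<open>2 * (L div h)\<close>.\<close>

lemma decoder_error_le:
  assumes k: "k \<in> {1..K}" and h: "0 < h"
    and w: "w k < m" and cw: "\<And>v. v < m \<Longrightarrow> cw k v \<in> PiE {..<L} (\<lambda>_. symbols Q k)"
    and dist: "\<And>v v'. v < m \<Longrightarrow> v' < m \<Longrightarrow> v \<noteq> v' \<Longrightarrow> 2 * (2 * (L div h)) < hdist L (cw k v) (cw k v')"
    and B: "B \<in> sets (Gd k)" "measure (Gd k) B \<le> (1 / 2 ^ (T * N k + 1)) ^ h"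
    and noise: "measure CN01 {z \<in> space CN01. \<tau> < cmod z} \<le> (1 / 2 ^ (T * N k + 1)) ^ h"
    and cond: "\<And>G. G \<in> space (Gd k) - B \<Longrightarrow> well_conditioned k \<kappa> G"
    and \<gamma>: "0 < \<gamma>" "2 * \<kappa> * \<tau> * (1 + 2 * real (nstar k)) < \<gamma> * (1 / real (Q k))"
  shows "measure (user_space (Gd k) (N k) T L) {\<omega> \<in> space (user_space (Gd k) (N k) T L).
     decoder Q \<tau> L (2 * (L div h)) m (cw k) k (received M T (N k) (U k) (s k) (r k) L (encoder \<gamma> Q cw w) \<omega>) \<noteq> w k}
       \<le> 2 * (1 / 2) ^ L"
proof -
  let ?\<Omega> = "user_space (Gd k) (N k) T L"
  have "(\<lambda>z. cmod z) \<in> borel_measurable CN01" by measurable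
  hence Bw: "{z \<in> space CN01. \<tau> < cmod z} \<in> sets CN01" by measurable
  have Nk: "0 < N k" using dims(1)[OF k] by simp
  obtain E where E: "E \<in> sets ?\<Omega>" "measure ?\<Omega> E \<le> 2 * (1 / 2) ^ L"
    "\<And>\<omega>. \<omega> \<in> space ?\<Omega> - E \<Longrightarrow>
     card {l. l < L \<and> (fst \<omega> l \<in> B \<or> (\<exists>t<T. \<exists>a<N k. snd \<omega> (l * T + t, a) \<in> {z \<in> space CN01. \<tau> < cmod z}))} \<le> 2 * (L div h)"
    by (rule bad_block_event[OF Gprob[OF k] B(1) Bw h T_pos Nk B(2) noise, of L], rule that)
  interpret \<Omega>: prob_space ?\<Omega>
    unfolding user_space_def using Gprob[OF k] prob_space_CN01
    by (intro prob_space_pair prob_space_PiM)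
  have "{\<omega> \<in> space ?\<Omega>. decoder Q \<tau> L (2 * (L div h)) m (cw k) k
      (received M T (N k) (U k) (s k) (r k) L (encoder \<gamma> Q cw w) \<omega>) \<noteq> w k} \<subseteq> E"
  proof (intro subsetI, elim CollectE conjE, rule ccontr)
    fix \<omega> assume \<omega>: "\<omega> \<in> space ?\<Omega>" "\<omega> \<notin> E" and
      ne: "decoder Q \<tau> L (2 * (L div h)) m (cw k) k
        (received M T (N k) (U k) (s k) (r k) L (encoder \<gamma> Q cw w) \<omega>) \<noteq> w k"
    have sp: "fst \<omega> l \<in> space (Gd k)" if "l < L" for l
      using \<omega>(1) that by (auto simp: user_space_def space_pair_measure space_PiM)
    have "decoder Q \<tau> L (2 * (L div h)) m (cw k) k
        (received M T (N k) (U k) (s k) (r k) L (encoder \<gamma> Q cw w) \<omega>) = w k"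
      by (rule decoder_correct[where w = w and cw = cw, OF k sp w cw dist E(3)[OF DiffI[OF \<omega>]] cond \<gamma>])
    with ne show False ..
  qed
  from \<Omega>.finite_measure_mono[OF this E(1)] E(2) show ?thesis by linarith
qed

section \<open>Achievable rates and degrees of freedom\<close>

text \<open>Codebooks are chosen for each user separately, as each decoder works whatever letters
  the other users send. \<open>T * R k\<close> is the rate per block, the unit of the code over
  blocks.\<close>

lemma achievable_ratesI:
  fixes \<rho> C :: real and Q :: "nat \<Rightarrow> nat"
  assumes \<rho>: "0 < \<rho>" and C: "0 < C" "\<And>D t. (\<And>c t. cmod (D c t) \<le> 2) \<Longrightarrow> t < T \<Longrightarrow>
     (\<Sum>i<M. (cmod (beam (\<lambda>c. precoder D c t) i))\<^sup>2) \<le> C"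
    and h: "0 < h"
    and B: "\<And>k. k \<in> {1..K} \<Longrightarrow> B k \<in> sets (Gd k)"
      "\<And>k. k \<in> {1..K} \<Longrightarrow> measure (Gd k) (B k) \<le> (1 / 2 ^ (T * N k + 1)) ^ h"
    and noise: "\<And>k. k \<in> {1..K} \<Longrightarrow> measure CN01 {z \<in> space CN01. \<tau> k < cmod z} \<le> (1 / 2 ^ (T * N k + 1)) ^ h"
    and cond: "\<And>k G. k \<in> {1..K} \<Longrightarrow> G \<in> space (Gd k) - B k \<Longrightarrow> well_conditioned k (\<kappa> k) G"
    and Q: "\<And>k. k \<in> {1..K} \<Longrightarrow> 0 < Q k"
      "\<And>k. k \<in> {1..K} \<Longrightarrow> 2 * \<kappa> k * \<tau> k * (1 + 2 * real (nstar k)) < sqrt (\<rho> / C) * (1 / real (Q k))"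
    and R: "\<And>k. k \<in> {1..K} \<Longrightarrow> 0 \<le> R k"
      "\<And>k. k \<in> {1..K} \<Longrightarrow> real T * R k \<le> 0 \<or>
         real T * R k \<le> (1 - 4 / real h) * ln (real (card (symbols Q k))) - ln 2"
  shows "achievable_rates M K T N U s r Gd \<rho> R"
  unfolding achievable_rates_def
proof (intro conjI ballI allI impI)
  fix \<epsilon> :: real assume \<epsilon>: "0 < \<epsilon>"
  have "(\<lambda>L. 2 * (1 / 2 :: real) ^ L) \<longlonglongrightarrow> 0"
    by (intro tendsto_mult_right_zero LIMSEQ_power_zero) simp
  from order_tendstoD(2)[OF this \<epsilon>] obtain L0 where L0: "\<And>L. L0 \<le> L \<Longrightarrow> 2 * (1 / 2 :: real) ^ L < \<epsilon>"
    by (auto simp: eventually_sequentially)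
  let ?\<gamma> = "sqrt (\<rho> / C)"
  have \<gamma>: "0 < ?\<gamma>" using \<rho> C(1) by simp
  show "\<exists>L0. \<forall>L\<ge>L0. \<exists>m f g.
        (\<forall>k\<in>{1..K}. exp (real (L * T) * R k) \<le> real (m k)) \<and>
        (\<forall>w\<in>messages K m. (1 / real (L * T)) * (\<Sum>j<L*T. \<Sum>i<M. (cmod (f w j i))\<^sup>2) \<le> \<rho>) \<and>
        (\<forall>k\<in>{1..K}. g k \<in> measurable (out_space (N k) (L * T)) (count_space UNIV)) \<and>
        (\<forall>k\<in>{1..K}. err_prob M K T N U s r Gd L m f g k \<le> \<epsilon>)"
  proof (intro exI[of _ L0] allI impI)
    fix L assume L: "L0 \<le> L"
    let ?e = "2 * (L div h)"
    let ?P = "\<lambda>k m cw. 0 < m \<and> exp (real L * (real T * R k)) \<le> real m \<and>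
        (\<forall>v<m. cw v \<in> PiE {..<L} (\<lambda>_. symbols Q k)) \<and>
        (\<forall>v<m. \<forall>v'<m. v \<noteq> v' \<longrightarrow> 2 * ?e < hdist L (cw v) (cw v'))"
    have "\<forall>k\<in>{1..K}. \<exists>m cw. ?P k m cw"
    proof
      fix k assume k: "k \<in> {1..K}"
      have "card (symbols Q k) \<noteq> 0" using Q(1)[OF k] by (simp add: card_symbols)
      hence ne: "symbols Q k \<noteq> {}" by auto
      show "\<exists>m cw. ?P k m cw"
      proof (rule codebook_exists[OF finite_symbols ne h R(2)[OF k], of L])
        fix m and cw :: "nat \<Rightarrow> nat \<Rightarrow> nat \<times> nat \<Rightarrow> nat \<times> nat"
        assume "0 < m" "exp (real L * (real T * R k)) \<le> real m"
          "\<And>v. v < m \<Longrightarrow> cw v \<in> PiE {..<L} (\<lambda>_. symbols Q k)"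
          "\<And>v v'. v < m \<Longrightarrow> v' < m \<Longrightarrow> v \<noteq> v' \<Longrightarrow> 4 * (L div h) < hdist L (cw v) (cw v')"
        thus "\<exists>m cw. ?P k m cw" by (intro exI[of _ m] exI[of _ cw]) simp
      qed
    qed
    from bchoice[OF this] obtain m where "\<forall>k\<in>{1..K}. \<exists>cw. ?P k (m k) cw" ..
    from bchoice[OF this] obtain cw where "\<forall>k\<in>{1..K}. ?P k (m k) (cw k)" ..
    hence m: "\<And>k. k \<in> {1..K} \<Longrightarrow> 0 < m k"
      and rate: "\<And>k. k \<in> {1..K} \<Longrightarrow> exp (real L * (real T * R k)) \<le> real (m k)"
      and cw: "\<And>k v. k \<in> {1..K} \<Longrightarrow> v < m k \<Longrightarrow> cw k v \<in> PiE {..<L} (\<lambda>_. symbols Q k)"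
      and dist: "\<And>k v v'. k \<in> {1..K} \<Longrightarrow> v < m k \<Longrightarrow> v' < m k \<Longrightarrow> v \<noteq> v' \<Longrightarrow> 2 * ?e < hdist L (cw k v) (cw k v')"
      by blast+
    define f where "f = encoder ?\<gamma> Q cw"
    define g where "g k = decoder Q (\<tau> k) L ?e (m k) (cw k) k" for k
    have err: "err_prob M K T N U s r Gd L m f g k \<le> \<epsilon>" if k: "k \<in> {1..K}" for k
    proof -
      let ?\<Omega> = "user_space (Gd k) (N k) T L"
      have "(\<Sum>w\<in>messages K m. measure ?\<Omega> {\<omega> \<in> space ?\<Omega>.
             g k (received M T (N k) (U k) (s k) (r k) L (f w) \<omega>) \<noteq> w k}) \<le> real (card (messages K m)) * \<epsilon>"
      proof (rule sum_bounded_above)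
        fix w assume "w \<in> messages K m"
        hence w: "w k < m k" using k by (auto simp: messages_def)
        have "measure ?\<Omega> {\<omega> \<in> space ?\<Omega>. g k (received M T (N k) (U k) (s k) (r k) L (f w) \<omega>) \<noteq> w k} \<le> 2 * (1 / 2) ^ L"
          unfolding g_def f_def
          by (rule decoder_error_le[where w = w and cw = cw,
                OF k h w cw[OF k] dist[OF k] B(1)[OF k] B(2)[OF k] noise[OF k] cond[OF k] \<gamma> Q(2)[OF k]])
        thus "measure ?\<Omega> {\<omega> \<in> space ?\<Omega>. g k (received M T (N k) (U k) (s k) (r k) L (f w) \<omega>) \<noteq> w k} \<le> \<epsilon>"
          using L0[OF L] by linarith
      qed
      moreover have "0 < card (messages K m)"
        using prod_pos[of "{1..K}" m, OF m] by (simp add: messages_def card_PiE)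
      ultimately show ?thesis unfolding err_prob_def by (simp add: field_simps)
    qed
    show "\<exists>m f g.
        (\<forall>k\<in>{1..K}. exp (real (L * T) * R k) \<le> real (m k)) \<and>
        (\<forall>w\<in>messages K m. (1 / real (L * T)) * (\<Sum>j<L*T. \<Sum>i<M. (cmod (f w j i))\<^sup>2) \<le> \<rho>) \<and>
        (\<forall>k\<in>{1..K}. g k \<in> measurable (out_space (N k) (L * T)) (count_space UNIV)) \<and>
        (\<forall>k\<in>{1..K}. err_prob M K T N U s r Gd L m f g k \<le> \<epsilon>)"
    proof (intro exI conjI ballI)
      show "exp (real (L * T) * R k) \<le> real (m k)" if "k \<in> {1..K}" for k
        using rate[OF that] by (simp add: mult.assoc)
      show "1 / real (L * T) * (\<Sum>j<L*T. \<Sum>i<M. (cmod (f w j i))\<^sup>2) \<le> \<rho>" for w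
        unfolding f_def by (rule encoder_power[OF C \<rho>])
      show "g k \<in> measurable (out_space (N k) (L * T)) (count_space UNIV)" if "k \<in> {1..K}" for k
        unfolding g_def by (rule measurable_decoder[OF that])
    qed (rule err)
  qed
qed (rule R(1))

text \<open>One message and zero input. It fills in the SNRs at which the scheme does not work yet,
  since rates are demanded at every \<open>\<rho> > 0\<close>.\<close>

lemma achievable_rates_zero: "0 < \<rho> \<Longrightarrow> achievable_rates M K T N U s r Gd \<rho> (\<lambda>_. 0)"
  unfolding achievable_rates_def
  by (intro conjI ballI allI impI exI[of _ 0] exI[of _ "\<lambda>_. 1"] exI[of _ "\<lambda>_ _ _. 0"] exI[of _ "\<lambda>_ _. 0"])
    (auto simp: err_prob_def messages_def PiE_iff intro!: mult_nonneg_nonpos sum_nonpos)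

text \<open>The rate loss \<open>\<eta>\<close> fixes \<open>h\<close>, hence the allowed failure
  probabilities, hence \<open>\<kappa>\<close> and \<open>\<tau>\<close>, all independently of
  \<open>\<rho>\<close>. Only the grid size \<open>Q\<close> grows, like
  \<open>sqrt \<rho>\<close>.\<close>

lemma eventually_achievable_rates:
  assumes \<eta>: "0 < \<eta>" "\<eta> < 1"
  shows "eventually (\<lambda>\<rho>. achievable_rates M K T N U s r Gd \<rho> (\<lambda>k. (1 - \<eta>) * (real (num_streams k) / real T) * ln \<rho>)) at_top"
proof -
  obtain C where C: "0 < C" "\<forall>D t. (\<forall>c t. cmod (D c t) \<le> 2) \<longrightarrow> t < T \<longrightarrow>
     (\<Sum>i<M. (cmod (beam (\<lambda>c. precoder D c t) i))\<^sup>2) \<le> C"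
    using beam_power_bound by blast
  \<comment> \<open>This puts the fraction \<open>4 / h\<close> of the rate, spent on the code
    distance, below \<open>\<eta>\<close>.\<close>
  obtain h :: nat where "4 / \<eta> < real h" using reals_Archimedean2 by blast
  moreover from this have h: "0 < h" using \<eta>(1) by (intro gr0I) (auto simp: field_simps)
  ultimately have h4: "4 / real h < \<eta>" using \<eta>(1) by (simp add: field_simps)
  let ?p = "\<lambda>k. (1 / 2 ^ (T * N k + 1)) ^ h :: real"
  have "\<forall>k\<in>{1..K}. \<exists>\<kappa>B. 0 < fst \<kappa>B \<and> snd \<kappa>B \<in> sets (Gd k) \<and> measure (Gd k) (snd \<kappa>B) < ?p k \<and>
     (\<forall>G\<in>space (Gd k) - snd \<kappa>B. well_conditioned k (fst \<kappa>B) G)"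
  proof
    fix k assume k: "k \<in> {1..K}"
    have p: "0 < ?p k" by simp
    show "\<exists>\<kappa>B. 0 < fst \<kappa>B \<and> snd \<kappa>B \<in> sets (Gd k) \<and> measure (Gd k) (snd \<kappa>B) < ?p k \<and>
      (\<forall>G\<in>space (Gd k) - snd \<kappa>B. well_conditioned k (fst \<kappa>B) G)"
    proof (rule gain_well_conditioned[OF k p])
      fix \<kappa> B assume "0 < \<kappa>" "B \<in> sets (Gd k)" "measure (Gd k) B < ?p k"
        "\<And>G. G \<in> space (Gd k) - B \<Longrightarrow> well_conditioned k \<kappa> G"
      thus "\<exists>\<kappa>B. 0 < fst \<kappa>B \<and> snd \<kappa>B \<in> sets (Gd k) \<and> measure (Gd k) (snd \<kappa>B) < ?p k \<and>
          (\<forall>G\<in>space (Gd k) - snd \<kappa>B. well_conditioned k (fst \<kappa>B) G)"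
        by (intro exI[of _ "(\<kappa>, B)"]) simp
    qed
  qed
  from bchoice[OF this] obtain \<kappa>B where \<kappa>B: "\<forall>k\<in>{1..K}. 0 < fst (\<kappa>B k) \<and> snd (\<kappa>B k) \<in> sets (Gd k) \<and>
     measure (Gd k) (snd (\<kappa>B k)) < ?p k \<and>
     (\<forall>G\<in>space (Gd k) - snd (\<kappa>B k). well_conditioned k (fst (\<kappa>B k)) G)" ..
  define \<kappa> B where "\<kappa> k = fst (\<kappa>B k)" and "B k = snd (\<kappa>B k)" for k
  from \<kappa>B have \<kappa>: "\<And>k. k \<in> {1..K} \<Longrightarrow> 0 < \<kappa> k"
    and B: "\<And>k. k \<in> {1..K} \<Longrightarrow> B k \<in> sets (Gd k)"
      "\<And>k. k \<in> {1..K} \<Longrightarrow> measure (Gd k) (B k) \<le> ?p k"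
    and cond: "\<And>k G. k \<in> {1..K} \<Longrightarrow> G \<in> space (Gd k) - B k \<Longrightarrow> well_conditioned k (\<kappa> k) G"
    unfolding \<kappa>_def B_def by (blast intro: less_imp_le)+
  have "\<exists>\<tau>. 0 < \<tau> \<and> measure CN01 {z \<in> space CN01. \<tau> < cmod z} \<le> ?p k" for k
  proof -
    interpret prob_space CN01 by (rule prob_space_CN01)
    have "(\<lambda>z. cmod z) \<in> borel_measurable CN01" by measurable
    moreover have "0 < ?p k" by simp
    ultimately obtain \<tau> where "0 < \<tau>" "prob {z \<in> space CN01. \<tau> < cmod z} < ?p k"
      by (rule prob_greater_small)
    thus ?thesis by (intro exI[of _ \<tau>]) simp
  qed
  then obtain \<tau> where \<tau>: "\<And>k. 0 < \<tau> k" "\<And>k. measure CN01 {z \<in> space CN01. \<tau> k < cmod z} \<le> ?p k"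
    by metis
  define c where "c k = 2 * \<kappa> k * \<tau> k * (1 + 2 * real (nstar k))" for k
  have c: "0 < c k" if "k \<in> {1..K}" for k
    unfolding c_def using \<kappa>[OF that] \<tau>(1) by (intro mult_pos_pos add_pos_nonneg) auto
  \<comment> \<open>Half of the limit set by the separation condition of the test, so that the
    condition holds strictly.\<close>
  define \<beta> where "\<beta> k = 1 / (2 * c k * sqrt C)" for k
  define Q where "Q \<rho> k = nat \<lfloor>\<beta> k * sqrt \<rho>\<rfloor>" for \<rho> k
  have \<beta>: "0 < \<beta> k" if "k \<in> {1..K}" for k using c[OF that] C(1) by (simp add: \<beta>_def)
  have "eventually (\<lambda>\<rho>. \<forall>k\<in>{1..K}. 0 < Q \<rho> k \<and> ((1 - \<eta>) * real (num_streams k) * ln \<rho> \<le> 0 \<or>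
     (1 - \<eta>) * real (num_streams k) * ln \<rho> \<le> (1 - 4 / real h) * ln (real ((Q \<rho> k * Q \<rho> k) ^ num_streams k)) - ln 2)) at_top"
    unfolding Q_def by (intro eventually_ball_finite ballI eventually_rate \<beta> h4 \<eta>(2)) auto
  thus ?thesis using eventually_gt_at_top[of 1]
  proof eventually_elim
    case (elim \<rho>)
    show ?case
    proof (rule achievable_ratesI[where C = C and h = h and B = B and \<kappa> = \<kappa> and \<tau> = \<tau> and Q = "Q \<rho>"])
      show "(\<Sum>i<M. (cmod (beam (\<lambda>c. precoder D c t) i))\<^sup>2) \<le> C"
        if "\<And>c t. cmod (D c t) \<le> 2" "t < T" for D t
        using C(2) that by simp
      fix k assume k: "k \<in> {1..K}"
      show "0 < Q \<rho> k" using elim(1) k by blast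
      show "2 * \<kappa> k * \<tau> k * (1 + 2 * real (nstar k)) < sqrt (\<rho> / C) * (1 / real (Q \<rho> k))"
      proof -
        have "real (Q \<rho> k) \<le> \<beta> k * sqrt \<rho>" unfolding Q_def using \<beta>[OF k] elim(2) by simp
        hence "2 * c k * sqrt C * real (Q \<rho> k) \<le> sqrt \<rho>"
          using c[OF k] C(1) by (simp add: \<beta>_def field_simps)
        moreover have "0 < c k * sqrt C * real (Q \<rho> k)"
          using c[OF k] C(1) \<open>0 < Q \<rho> k\<close> by simp
        ultimately have "c k * sqrt C * real (Q \<rho> k) < sqrt \<rho>" by linarith
        thus ?thesis using C(1) \<open>0 < Q \<rho> k\<close> unfolding c_def[symmetric]
          by (simp add: real_sqrt_divide field_simps)
      qed
      show "0 \<le> (1 - \<eta>) * (real (num_streams k) / real T) * ln \<rho>"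
        using \<eta> elim(2) by simp
      have "real T * ((1 - \<eta>) * (real (num_streams k) / real T) * ln \<rho>) = (1 - \<eta>) * real (num_streams k) * ln \<rho>"
        using T_pos by simp
      thus "real T * ((1 - \<eta>) * (real (num_streams k) / real T) * ln \<rho>) \<le> 0 \<or>
         real T * ((1 - \<eta>) * (real (num_streams k) / real T) * ln \<rho>)
           \<le> (1 - 4 / real h) * ln (real (card (symbols (Q \<rho>) k))) - ln 2"
        using elim(1) k unfolding card_symbols by metis
    qed (use elim(2) C(1) h B \<tau>(2) cond in auto)
  qed
qed

lemma dof_achievable_streams: "dof_achievable M K T N U s r Gd (\<lambda>k. real (num_streams k) / real T)"
proof -
  let ?P = "\<lambda>\<eta> \<rho>. achievable_rates M K T N U s r Gd \<rho> (\<lambda>k. (1 - \<eta>) * (real (num_streams k) / real T) * ln \<rho>)"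
  obtain \<eta> where \<eta>: "(\<eta> \<longlongrightarrow> 0) at_top" and ev: "eventually (\<lambda>\<rho>. ?P (\<eta> \<rho>) \<rho>) at_top"
    using vanishing_selection[of ?P] eventually_achievable_rates by blast
  \<comment> \<open>Where the selected loss is not yet achievable the rate is \<open>0\<close>; this
    happens only for bounded \<open>\<rho>\<close> and leaves the limit unchanged.\<close>
  define R where "R \<rho> k = (if ?P (\<eta> \<rho>) \<rho> then (1 - \<eta> \<rho>) * (real (num_streams k) / real T) * ln \<rho> else 0)" for \<rho> k
  show ?thesis
    unfolding dof_achievable_def
  proof (intro exI[of _ R] conjI allI impI ballI)
    fix \<rho> :: real assume "0 < \<rho>"
    thus "achievable_rates M K T N U s r Gd \<rho> (R \<rho>)"
      unfolding R_def[abs_def] using achievable_rates_zero by (cases "?P (\<eta> \<rho>) \<rho>") auto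
  next
    fix k
    have "((\<lambda>\<rho>. (1 - \<eta> \<rho>) * (real (num_streams k) / real T)) \<longlongrightarrow> (1 - 0) * (real (num_streams k) / real T)) at_top"
      by (intro tendsto_intros \<eta>)
    moreover have "eventually (\<lambda>\<rho>. (1 - \<eta> \<rho>) * (real (num_streams k) / real T) = R \<rho> k / ln \<rho>) at_top"
      using ev eventually_gt_at_top[of 1] by eventually_elim (simp add: R_def)
    ultimately show "((\<lambda>\<rho>. R \<rho> k / ln \<rho>) \<longlongrightarrow> real (num_streams k) / real T) at_top"
      using tendsto_cong by fastforce
  qed
qed

end

theorem theorem9:
  fixes M K T :: nat and N r :: "nat \<Rightarrow> nat"
    and U :: "nat \<Rightarrow> nat \<Rightarrow> nat \<Rightarrow> complex" and s :: "nat \<Rightarrow> nat \<Rightarrow> real"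
    and Gd :: "nat \<Rightarrow> (nat \<times> nat \<Rightarrow> complex) measure"
  assumes K: "K \<ge> 1" and Mpos: "M \<ge> 1"
    and dims: "\<forall>k\<in>{1..K}. N k \<ge> 1 \<and> r k \<ge> 1"
    and orth: "\<forall>k\<in>{1..K}. \<forall>b<r k. \<forall>b'<r k.
                 (\<Sum>i<M. cnj (U k i b) * U k i b') = (if b = b' then 1 else 0)"
    and spos: "\<forall>k\<in>{1..K}. \<forall>b<r k. s k b > 0"
    and trace: "\<forall>k\<in>{1..K}. (\<Sum>b<r k. s k b) = real M"
    and Gprob: "\<forall>k\<in>{1..K}. prob_space (Gd k) \<and> sets (Gd k) = sets (Gspace (N k) (r k))"
    and Gent: "\<forall>k\<in>{1..K}. diff_entropy_gt_minf (Gd k) (N k) (r k)"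
    and Gmom: "\<forall>k\<in>{1..K}. \<forall>b<r k. \<forall>b'<r k.
                 integrable (Gd k) (\<lambda>G. \<Sum>a<N k. cnj (G (a, b)) * G (a, b')) \<and>
                 (\<integral>G. (\<Sum>a<N k. cnj (G (a, b)) * G (a, b')) \<partial>Gd k) =
                   (if b = b' then of_nat (N k) else 0)"
    and T: "\<forall>k\<in>{1..K}. T \<ge> 2 * max (r k) (N k)"
    and nested: "\<forall>k\<in>{2..K}. r k \<le> r (k - 1) \<and>
        (\<exists>Ubar :: nat \<Rightarrow> nat \<Rightarrow> complex.
           (\<forall>c<r (k - 1) - r k. \<forall>c'<r (k - 1) - r k.
              (\<Sum>i<M. cnj (Ubar i c) * Ubar i c') = (if c = c' then 1 else 0)) \<and>
           (\<forall>c<r (k - 1) - r k. \<forall>b<r k. (\<Sum>i<M. cnj (Ubar i c) * U k i b) = 0) \<and>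
           (\<forall>i<M. \<forall>c<r (k - 1).
              U (k - 1) i c = (if c < r (k - 1) - r k then Ubar i c
                               else U k i (c - (r (k - 1) - r k)))))"
  shows "dof_achievable M K T N U s r Gd
           (\<lambda>k. if k = 1 then real (min (N 1) (r 1)) * (1 - real (r 1) / real T)
                else real (min (N k) (r k)) * ((real (r (k - 1)) - real (r k)) / real T))"
proof -
  interpret nested_broadcast M K T N r U s Gd
  proof (rule nested_broadcast.intro)
    show "1 \<le> K" by (rule K)
    show "1 \<le> N k" "1 \<le> r k" if "k \<in> {1..K}" for k using dims that by auto
    show "(\<Sum>i<M. cnj (U 1 i b) * U 1 i b') = (if b = b' then 1 else 0)" if "b < r 1" "b' < r 1" for b b'
      using orth K that by (metis atLeastAtMost_iff le_refl)
    show "0 < s k b" if "k \<in> {1..K}" "b < r k" for k b using spos that by blast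
    show "prob_space (Gd k)" if "k \<in> {1..K}" for k using Gprob that by blast
    show "diff_entropy_gt_minf (Gd k) (N k) (r k)" if "k \<in> {1..K}" for k using Gent that by blast
    have "2 * max (r 1) (N 1) \<le> T" using T K by auto
    thus "2 * r 1 \<le> T" by linarith
    show "r k \<le> r (k - 1)" if "k \<in> {2..K}" for k using nested that by blast
    show "U (k - 1) i (r (k - 1) - r k + b) = U k i b" if k: "k \<in> {2..K}" and "i < M" "b < r k" for k i b
    proof -
      obtain Ubar where Ubar: "\<forall>i<M. \<forall>c<r (k - 1). U (k - 1) i c = (if c < r (k - 1) - r k then Ubar i c
          else U k i (c - (r (k - 1) - r k)))" and le: "r k \<le> r (k - 1)"
        using nested[rule_format, OF k] by blast
      have "r (k - 1) - r k + b < r (k - 1)" using le that(3) by linarith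
      from Ubar[rule_format, OF that(2) this] show ?thesis by simp
    qed
  qed
  \<comment> \<open>The case split is that of \<open>slot_end\<close>, and
    \<open>r k \<le> slot_end k\<close> makes the subtraction of natural numbers in
    \<open>num_streams\<close> exact.\<close>
  have "(\<lambda>k. if k = 1 then real (min (N 1) (r 1)) * (1 - real (r 1) / real T)
      else real (min (N k) (r k)) * ((real (r (k - 1)) - real (r k)) / real T)) k = real (num_streams k) / real T"
    if "k \<in> {1..K}" for k
    using r_le_slot_end[OF that] T_pos
    by (auto simp: num_streams_def nstar_def slot_end_def of_nat_diff field_simps)
  thus ?thesis
    using dof_achievable_streams unfolding dof_achievable_def by simp
qed

end
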